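(* There is a function $f$ of two nonnegative real variables, satisfying $f(\lambda_1,\lambda_2)\le \lambda_1+\lambda_2+\lambda_2^2$ for all $\lambda_1,\lambda_2$ and $f(\lambda_1,\lambda_2)<1$ whenever $\lambda_1,\lambda_2<1$, such that the following holds. If $G_1$ is an $(N_1,D_1,\lambda_1)$-graph on $[N_1]$ and $G_2$ is a $(D_1,D_2,\lambda_2)$-graph on $[D_1]$, then their zig-zag product $G$ is an $(N_1\cdot D_1,\, D_2^2,\, f(\lambda_1,\lambda_2))$-graph. Moreover, $\mathrm{Rot}_{G}$ can be computed in time $\mathrm{poly}(\log N_1,\log D_1,\log D_2)$ with one oracle query to $\mathrm{Rot}_{G_1}$ and two oracle queries to $\mathrm{Rot}_{G_2}$.
   Context: For a positive integer $n$, $[n]=\{1,\dots,n\}$. Graphs are finite, undirected and regular, and may have self-loops and parallel edges. A $D$-regular graph $G$ on $[N]$ is specified by its rotation map $\mathrm{Rot}_G:[N]\times[D]\to[N]\times[D]$: $\mathrm{Rot}_G(v,i)=(w,j)$ means that the $i$-th edge incident to $v$ leads to $w$ and that this edge is the $j$-th edge incident to $w$. Thus $\mathrm{Rot}_G$ is a permutation with $\mathrm{Rot}_G\circ\mathrm{Rot}_G=\mathrm{id}$ (and any such involution specifies a $D$-regular graph). Vertex sets and sets of edge labels may be any finite sets of the right cardinality. The normalized adjacency matrix of $G$ is the symmetric $N\times N$ matrix with $M_{u,v}=\frac1D|\{(i,j)\in[D]^2:\mathrm{Rot}_G(u,i)=(v,j)\}|$. The second largest eigenvalue in absolute value is $\lambda(G)=\max_{\alpha\perp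 1_N,\,\alpha\ne0}\|M\alpha\|/\|\alpha\|$, where $1_N$ is the all-ones vector and the norm is Euclidean (with $\lambda(G)=0$ if $N=1$). An $(N,D,\lambda)$-graph is a $D$-regular graph on $N$ vertices with $\lambda(G)\le\lambda$. Zig-zag product: for a $D_1$-regular graph $G_1$ on $[N_1]$ and a $D_2$-regular graph $G_2$ on $[D_1]$, it is the $D_2^2$-regular graph on $[N_1]\times[D_1]$, with edge labels in $[D_2]\times[D_2]$, whose rotation map sends $((v,k),(i,j))$ to $((w,\ell),(j',i'))$, where $(k',i')=\mathrm{Rot}_{G_2}(k,i)$, then $(w,\ell')=\mathrm{Rot}_{G_1}(v,k')$, then $(\ell,j')=\mathrm{Rot}_{G_2}(\ell',j)$. Computation: $\mathrm{poly}(\cdot)$ denotes a fixed unspecified polynomial in its arguments. An algorithm with oracle access to a function may evaluate it on inputs of its choice at the cost of one time step per evaluation. One single algorithm, given the parameters as additional input, works for all graphs; the time and query counts are per evaluation of the rotation map. *)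

theory Defs
  imports "HOL-Analysis.Analysis"
begin

section \<open>Regular graphs given by rotation maps\<close>

text \<open>A graph is a vertex set \<open>V\<close>, a set \<open>E\<close> of edge labels (so the degree is \<open>card E\<close>) and a
  rotation map \<open>R\<close>, whose values outside \<open>V \<times> E\<close> are irrelevant.\<close>

type_synonym ('v, 'e) rotation = "'v \<times> 'e \<Rightarrow> 'v \<times> 'e"

definition regular_graph :: "'v set \<Rightarrow> 'e set \<Rightarrow> ('v, 'e) rotation \<Rightarrow> bool" where
  "regular_graph V E R \<longleftrightarrow>
     finite V \<and> V \<noteq> {} \<and> finite E \<and> E \<noteq> {} \<and>
     (\<forall>x \<in> V \<times> E. R x \<in> V \<times> E \<and> R (R x) = x)"

definition norm_adj :: "'e set \<Rightarrow> ('v, 'e) rotation \<Rightarrow> 'v \<Rightarrow> 'v \<Rightarrow> real" where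
  "norm_adj E R u v = real (card {(i, j) \<in> E \<times> E. R (u, i) = (v, j)}) / real (card E)"

definition apply_adj :: "'v set \<Rightarrow> 'e set \<Rightarrow> ('v, 'e) rotation \<Rightarrow> ('v \<Rightarrow> real) \<Rightarrow> 'v \<Rightarrow> real" where
  "apply_adj V E R \<alpha> = (\<lambda>u. \<Sum>v\<in>V. norm_adj E R u v * \<alpha> v)"

text \<open>Vectors are functions restricted to \<open>V\<close>. The supremum is a maximum: the quotient is
  homogeneous and continuous, hence attains its bound on the unit sphere of the hyperplane
  orthogonal to the all-ones vector, which is compact, and nonempty unless \<open>card V = 1\<close>.\<close>

definition second_eigenvalue :: "'v set \<Rightarrow> 'e set \<Rightarrow> ('v, 'e) rotation \<Rightarrow> real" where
  "second_eigenvalue V E R =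
     (if card V = 1 then 0
      else Sup {L2_set (apply_adj V E R \<alpha>) V / L2_set \<alpha> V | \<alpha>.
                 (\<Sum>v\<in>V. \<alpha> v * 1) = 0 \<and> (\<exists>v\<in>V. \<alpha> v \<noteq> 0)})"

definition expander_graph ::
  "'v set \<Rightarrow> 'e set \<Rightarrow> ('v, 'e) rotation \<Rightarrow> nat \<Rightarrow> nat \<Rightarrow> real \<Rightarrow> bool" where
  "expander_graph V E R N D l \<longleftrightarrow>
     regular_graph V E R \<and> card V = N \<and> card E = D \<and> second_eigenvalue V E R \<le> l"

definition zigzag :: "('v, 'k) rotation \<Rightarrow> ('k, 'e) rotation \<Rightarrow> ('v \<times> 'k, 'e \<times> 'e) rotation" where
  "zigzag R1 R2 = (\<lambda>((v, k), (i, j)).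
     let (k', i') = R2 (k, i);
         (w, l') = R1 (v, k');
         (l, j') = R2 (l', j)
     in ((w, l), (j', i')))"


section \<open>Multi-tape Turing machines with two oracles\<close>

datatype sym = Blank | Zero | One | Sep

datatype move = Left | Stay | Right

fun offset :: "move \<Rightarrow> int" where
  "offset Left = -1" | "offset Stay = 0" | "offset Right = 1"

text \<open>A tape is two-way infinite, paired with the position of its head.\<close>

type_synonym tape = "(int \<Rightarrow> sym) \<times> int"

definition tape_of :: "sym list \<Rightarrow> tape" where
  "tape_of w = (\<lambda>p. if 0 \<le> p \<and> p < int (length w) then w ! nat p else Blank, 0)"

text \<open>The word on a tape starts at cell 0 and ends before the first blank; the position of the head
  does not matter. Reachable tapes have only finitely many non-blank cells.\<close>

definition word_of :: "tape \<Rightarrow> sym list" where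
  "word_of t = map (\<lambda>n. fst t (int n)) [0..<(LEAST n. fst t (int n) = Blank)]"

text \<open>States are indices into the list of actions, so the control is finite; a state beyond the end
  of the list is halting. \<open>Step \<delta>\<close> maps the scanned symbols to the next state together with, for
  each tape, the symbol written and the move of the head. \<open>Ask1 q\<close> and \<open>Ask2 q\<close> consult an oracle
  and continue in state \<open>q\<close>.\<close>

datatype action = Step "sym list \<Rightarrow> nat \<times> (sym \<times> move) list" | Ask1 nat | Ask2 nat

record machine =
  num_tapes :: nat
  prog :: "action list"

text \<open>Tape 0 holds the input, tape 1 is the query tape, tape 2 the oracle answer tape and tape 3 the
  output tape; all others are work tapes.\<close>

definition wf_machine :: "machine \<Rightarrow> bool" where
  "wf_machine M \<longleftrightarrow> 4 \<le> num_tapes M \<and>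
     (\<forall>\<delta> xs. Step \<delta> \<in> set (prog M) \<longrightarrow> length xs = num_tapes M \<longrightarrow>
        length (snd (\<delta> xs)) = num_tapes M)"

type_synonym config = "nat \<times> tape list"

definition init_config :: "machine \<Rightarrow> sym list \<Rightarrow> config" where
  "init_config M w = (0, tape_of w # replicate (num_tapes M - 1) (tape_of []))"

definition halted :: "machine \<Rightarrow> config \<Rightarrow> bool" where
  "halted M c \<longleftrightarrow> length (prog M) \<le> fst c"

definition scanned :: "tape list \<Rightarrow> sym list" where
  "scanned ts = map (\<lambda>(c, h). c h) ts"

definition act :: "(sym \<times> move) list \<Rightarrow> tape list \<Rightarrow> tape list" where
  "act as ts = map2 (\<lambda>(s, m) (c, h). (c(h := s), h + offset m)) as ts"

definition consult :: "(sym list \<Rightarrow> sym list) \<Rightarrow> tape list \<Rightarrow> tape list" where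
  "consult f ts = ts[1 := tape_of [], 2 := tape_of (f (word_of (ts ! 1)))]"

text \<open>\<open>run M f1 f2 c t q1 q2 c'\<close>: with oracles \<open>f1\<close> and \<open>f2\<close>, configuration \<open>c\<close> leads to \<open>c'\<close> in
  exactly \<open>t\<close> steps, of which \<open>q1\<close> query \<open>f1\<close> and \<open>q2\<close> query \<open>f2\<close>.\<close>

inductive run :: "machine \<Rightarrow> (sym list \<Rightarrow> sym list) \<Rightarrow> (sym list \<Rightarrow> sym list) \<Rightarrow>
    config \<Rightarrow> nat \<Rightarrow> nat \<Rightarrow> nat \<Rightarrow> config \<Rightarrow> bool"
  for M f1 f2 where
  refl: "run M f1 f2 c 0 0 0 c"
| step: "\<lbrakk>q < length (prog M); prog M ! q = Step \<delta>; \<delta> (scanned ts) = (q', as);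
          run M f1 f2 (q', act as ts) t q1 q2 c\<rbrakk>
         \<Longrightarrow> run M f1 f2 (q, ts) (Suc t) q1 q2 c"
| ask1: "\<lbrakk>q < length (prog M); prog M ! q = Ask1 q';
          run M f1 f2 (q', consult f1 ts) t q1 q2 c\<rbrakk>
         \<Longrightarrow> run M f1 f2 (q, ts) (Suc t) (Suc q1) q2 c"
| ask2: "\<lbrakk>q < length (prog M); prog M ! q = Ask2 q';
          run M f1 f2 (q', consult f2 ts) t q1 q2 c\<rbrakk>
         \<Longrightarrow> run M f1 f2 (q, ts) (Suc t) q1 (Suc q2) c"

definition computes_within :: "machine \<Rightarrow> (sym list \<Rightarrow> sym list) \<Rightarrow> (sym list \<Rightarrow> sym list) \<Rightarrow>
    sym list \<Rightarrow> sym list \<Rightarrow> real \<Rightarrow> nat \<Rightarrow> nat \<Rightarrow> bool" where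
  "computes_within M f1 f2 inp out T q1 q2 \<longleftrightarrow>
     (\<exists>t c. run M f1 f2 (init_config M inp) t q1 q2 c \<and> halted M c \<and>
            real t \<le> T \<and> word_of (snd c ! 3) = out)"


section \<open>Encodings and polynomials\<close>

text \<open>Binary representation, least significant bit first.\<close>

fun bits :: "nat \<Rightarrow> sym list" where
  "bits n = (if n = 0 then [] else (if even n then Zero else One) # bits (n div 2))"

declare bits.simps [simp del]

definition encode :: "nat list \<Rightarrow> sym list" where
  "encode ns = concat (map (\<lambda>n. bits n @ [Sep]) ns)"

text \<open>Nothing is assumed about answers to strings that do not encode an element of the domain.\<close>

definition oracle_for :: "nat set \<Rightarrow> nat set \<Rightarrow> (nat, nat) rotation \<Rightarrow>
    (sym list \<Rightarrow> sym list) \<Rightarrow> bool" where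
  "oracle_for V E R f \<longleftrightarrow>
     (\<forall>v\<in>V. \<forall>i\<in>E. f (encode [v, i]) = encode [fst (R (v, i)), snd (R (v, i))])"

definition encode_pairs :: "(nat \<times> nat) \<times> (nat \<times> nat) \<Rightarrow> sym list" where
  "encode_pairs = (\<lambda>((a, b), (c, d)). encode [a, b, c, d])"

definition polynomial3 :: "(real \<Rightarrow> real \<Rightarrow> real \<Rightarrow> real) \<Rightarrow> bool" where
  "polynomial3 p \<longleftrightarrow> (\<exists>(d::nat) (c :: nat \<Rightarrow> nat \<Rightarrow> nat \<Rightarrow> real).
     \<forall>x y z. p x y z = (\<Sum>i\<le>d. \<Sum>j\<le>d. \<Sum>k\<le>d. c i j k * x ^ i * y ^ j * z ^ k))"

end

theory Submission
  imports Defs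
begin

text \<open>Split a vector on \<open>V \<times> K\<close> orthogonal to the constants into a part constant on every
  cloud \<open>{v} \<times> K\<close>, of norm \<open>p\<close>, and a part with sum zero on every cloud, of norm \<open>q\<close>. The
  normalized adjacency operator of the zig-zag product is \<open>B A B\<close>, where \<open>B\<close> applies the small
  graph inside each cloud (it fixes the first part and shrinks the second one by \<open>l2\<close>) and \<open>A\<close>
  is the permutation given by the rotation map of the large graph; the compression of \<open>A\<close> to the
  first part is the large graph itself, which shrinks by \<open>l1\<close>. If \<open>H\<close> and \<open>Z\<close> are the squared
  norms of the two parts after \<open>A B\<close>, then \<open>H + Z \<le> p\<^sup>2 + l2\<^sup>2 q\<^sup>2\<close>, because \<open>A\<close> is an
  isometry, and \<open>\<surd>H \<le> l1 p + l2 q\<close>. These two inequalities bound \<open>H + l2\<^sup>2 Z\<close>, the squared norm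
  after the last \<open>B\<close>, in two ways.\<close>

section \<open>The spectral bound\<close>

text \<open>For each label \<open>i\<close> the partner label \<open>j\<close> in
  \<open>norm_adj\<close> is forced to be \<open>snd (R (u, i))\<close>, so the matrix entry counts
  labels \<open>i\<close> alone; swapping the sums then leaves one term per label.\<close>

lemma apply_adj_eq_mean:
  assumes "regular_graph V E R" "u \<in> V"
  shows "apply_adj V E R \<alpha> u = (\<Sum>i\<in>E. \<alpha> (fst (R (u, i)))) / card E"
proof -
  have fin: "finite V" "finite E" and R: "\<And>i. i \<in> E \<Longrightarrow> R (u, i) \<in> V \<times> E"
    using assms by (auto simp: regular_graph_def)
  have cnt: "real (card {(i, j) \<in> E \<times> E. R (u, i) = (v, j)}) =
      (\<Sum>i\<in>E. if fst (R (u, i)) = v then 1 else 0)" for v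
  proof -
    have "{(i, j) \<in> E \<times> E. R (u, i) = (v, j)} =
        (\<lambda>i. (i, snd (R (u, i)))) ` {i \<in> E. fst (R (u, i)) = v}"
      using R by (force simp: image_iff prod_eq_iff)
    moreover have "inj_on (\<lambda>i. (i, snd (R (u, i)))) {i \<in> E. fst (R (u, i)) = v}"
      by (auto intro: inj_onI)
    ultimately have "card {(i, j) \<in> E \<times> E. R (u, i) = (v, j)} = card {i \<in> E. fst (R (u, i)) = v}"
      by (simp add: card_image)
    also have "real \<dots> = (\<Sum>i\<in>{i \<in> E. fst (R (u, i)) = v}. 1)" by simp
    also have "\<dots> = (\<Sum>i\<in>E. if fst (R (u, i)) = v then 1 else 0)"
      using fin by (intro sum.inter_filter)
    finally show ?thesis .
  qed
  have count_mult: "(\<Sum>i\<in>E. if fst (R (u, i)) = v then 1 else 0) * a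
      = (\<Sum>i\<in>E. if fst (R (u, i)) = v then a else 0)" for v and a :: real
    unfolding sum_distrib_right by (intro sum.cong) auto
  have "apply_adj V E R \<alpha> u = (\<Sum>v\<in>V. \<Sum>i\<in>E. (if fst (R (u, i)) = v then \<alpha> v else 0)) / card E"
    unfolding apply_adj_def norm_adj_def cnt sum_divide_distrib[of _ V]
    unfolding times_divide_eq_left count_mult ..
  also have "(\<Sum>v\<in>V. \<Sum>i\<in>E. (if fst (R (u, i)) = v then \<alpha> v else 0))
      = (\<Sum>i\<in>E. \<Sum>v\<in>V. (if fst (R (u, i)) = v then \<alpha> v else 0))"
    by (rule sum.swap)
  also have "\<dots> = (\<Sum>i\<in>E. \<alpha> (fst (R (u, i))))"
    using fin R by (intro sum.cong refl) (auto simp: mem_Times_iff)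
  finally show ?thesis .
qed

text \<open>An involution of \<open>V \<times> E\<close> is a bijection with itself as inverse. This
  is the source of every isometry argument below.\<close>

lemma sum_reindex_rotation:
  assumes "regular_graph V E R"
  shows "(\<Sum>v\<in>V. \<Sum>i\<in>E. F (R (v, i))) = (\<Sum>v\<in>V. \<Sum>i\<in>E. F (v, i))"
proof -
  have R: "\<And>x. x \<in> V \<times> E \<Longrightarrow> R x \<in> V \<times> E \<and> R (R x) = x"
    using assms by (auto simp: regular_graph_def)
  have "(\<Sum>x\<in>V \<times> E. F (R x)) = (\<Sum>x\<in>V \<times> E. F x)"
    by (rule sum.reindex_bij_witness[of _ R R]) (simp_all only: R)
  then show ?thesis by (simp add: sum.cartesian_product case_prod_beta)
qed

text \<open>Column sums are 1 because the rotation map permutes the edge ends. Hence the zero-sum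
  vectors form an invariant subspace.\<close>

lemma sum_apply_adj:
  assumes "regular_graph V E R"
  shows "(\<Sum>u\<in>V. apply_adj V E R \<alpha> u) = (\<Sum>u\<in>V. \<alpha> u)"
proof -
  have "card E > 0" using assms by (auto simp: regular_graph_def card_gt_0_iff)
  moreover have "(\<Sum>u\<in>V. apply_adj V E R \<alpha> u) = (\<Sum>u\<in>V. \<Sum>i\<in>E. \<alpha> (fst (R (u, i)))) / card E"
    using assms by (simp add: apply_adj_eq_mean sum_divide_distrib)
  moreover have "(\<Sum>u\<in>V. \<Sum>i\<in>E. \<alpha> (fst (R (u, i)))) = card E * (\<Sum>u\<in>V. \<alpha> u)"
    using sum_reindex_rotation[OF assms, of "\<lambda>x. \<alpha> (fst x)"] by (simp add: sum_distrib_left)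
  ultimately show ?thesis by simp
qed

lemma L2_set_pos: "finite A \<Longrightarrow> a \<in> A \<Longrightarrow> f a \<noteq> 0 \<Longrightarrow> 0 < L2_set f A"
  using L2_set_eq_0_iff[of A f] L2_set_nonneg[of f A] by (auto simp: less_le)

text \<open>Extracts a usable inequality from the supremum in \<open>second_eigenvalue\<close>. A
  real \<open>Sup\<close> is known to dominate the elements of a set only once the set is bounded
  above, so a crude bound by \<open>card V\<close> comes first.\<close>

lemma apply_adj_contracts:
  assumes G: "regular_graph V E R" and l: "second_eigenvalue V E R \<le> l" "0 \<le> l"
    and sum0: "(\<Sum>v\<in>V. \<alpha> v) = 0"
  shows "(\<Sum>v\<in>V. (apply_adj V E R \<alpha> v)\<^sup>2) \<le> l\<^sup>2 * (\<Sum>v\<in>V. (\<alpha> v)\<^sup>2)"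
proof (cases "\<exists>v\<in>V. \<alpha> v \<noteq> 0")
  case False
  then have "\<And>v. apply_adj V E R \<alpha> v = 0" by (simp add: apply_adj_def)
  then show ?thesis using l by (simp add: sum_nonneg)
next
  case True
  have fin: "finite V" "finite E" and E: "card E > 0"
    and R: "\<And>u i. u \<in> V \<Longrightarrow> i \<in> E \<Longrightarrow> R (u, i) \<in> V \<times> E"
    using G by (auto simp: regular_graph_def card_gt_0_iff)
  \<comment> \<open>On one vertex a zero-sum vector vanishes, so the \<open>Sup\<close> branch of
    the definition is the relevant one.\<close>
  have card: "card V \<noteq> 1"
  proof
    assume "card V = 1"
    then obtain x where "V = {x}" by (rule card_1_singletonE)
    then show False using True sum0 by simp
  qed
  let ?S = "{L2_set (apply_adj V E R \<alpha>) V / L2_set \<alpha> V | \<alpha>.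
                 (\<Sum>v\<in>V. \<alpha> v * 1) = 0 \<and> (\<exists>v\<in>V. \<alpha> v \<noteq> 0)}"
  have "bdd_above ?S"
  proof (rule bdd_aboveI, clarify)
    fix \<beta> :: "'a \<Rightarrow> real" and v assume v: "v \<in> V" "\<beta> v \<noteq> 0"
    \<comment> \<open>Each coordinate of the image is an average of coordinates of
      \<open>\<beta>\<close>, and none of these exceeds the norm in absolute value.\<close>
    have pt: "\<bar>apply_adj V E R \<beta> u\<bar> \<le> L2_set \<beta> V" if u: "u \<in> V" for u
    proof -
      have "\<bar>\<Sum>i\<in>E. \<beta> (fst (R (u, i)))\<bar> \<le> (\<Sum>i\<in>E. \<bar>\<beta> (fst (R (u, i)))\<bar>)" by (rule sum_abs)
      also have "\<dots> \<le> (\<Sum>i\<in>E. L2_set \<beta> V)"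
      proof (rule sum_mono)
        fix i assume "i \<in> E"
        then have "fst (R (u, i)) \<in> V" using R u by (auto simp: mem_Times_iff)
        then show "\<bar>\<beta> (fst (R (u, i)))\<bar> \<le> L2_set \<beta> V"
          using member_le_L2_set[OF fin(1), of _ "\<lambda>v. \<bar>\<beta> v\<bar>"] by (simp add: L2_set_def)
      qed
      finally show ?thesis using E apply_adj_eq_mean[OF G u]
        by (simp add: divide_le_eq mult.commute)
    qed
    have "L2_set (apply_adj V E R \<beta>) V \<le> (\<Sum>u\<in>V. \<bar>apply_adj V E R \<beta> u\<bar>)"
      by (rule L2_set_le_sum_abs)
    also have "\<dots> \<le> (\<Sum>u\<in>V. L2_set \<beta> V)" by (intro sum_mono pt)
    finally have "L2_set (apply_adj V E R \<beta>) V \<le> card V * L2_set \<beta> V" by simp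
    moreover have "L2_set \<beta> V > 0"
      by (rule L2_set_pos[where f = \<beta>, OF fin(1) v])
    ultimately show "L2_set (apply_adj V E R \<beta>) V / L2_set \<beta> V \<le> card V"
      by (simp add: divide_le_eq)
  qed
  moreover have "L2_set (apply_adj V E R \<alpha>) V / L2_set \<alpha> V \<in> ?S" using True sum0 by auto
  ultimately have "L2_set (apply_adj V E R \<alpha>) V / L2_set \<alpha> V \<le> Sup ?S" by (intro cSup_upper)
  also have "\<dots> \<le> l" using l card by (simp add: second_eigenvalue_def)
  finally have q: "L2_set (apply_adj V E R \<alpha>) V / L2_set \<alpha> V \<le> l" .
  have "L2_set \<alpha> V > 0"
    using True L2_set_pos[OF fin(1), where f = \<alpha>] by blast
  with q have "L2_set (apply_adj V E R \<alpha>) V \<le> l * L2_set \<alpha> V" by (simp add: divide_le_eq)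
  then have "(L2_set (apply_adj V E R \<alpha>) V)\<^sup>2 \<le> (l * L2_set \<alpha> V)\<^sup>2"
    by (intro power_mono) auto
  then show ?thesis by (simp add: L2_set_def power_mult_distrib sum_nonneg)
qed

text \<open>The converse passage, from squared norms back to the supremum; \<open>0 \<le> l\<close>
  covers the value 0 on a single vertex.\<close>

lemma second_eigenvalue_leI:
  assumes V: "finite V" "V \<noteq> {}" and l: "0 \<le> l"
    and bound: "\<And>\<alpha>. (\<Sum>v\<in>V. \<alpha> v) = 0 \<Longrightarrow>
      (\<Sum>v\<in>V. (apply_adj V E R \<alpha> v)\<^sup>2) \<le> l\<^sup>2 * (\<Sum>v\<in>V. (\<alpha> v)\<^sup>2)"
  shows "second_eigenvalue V E R \<le> l"
proof (cases "card V = 1")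
  case True
  then show ?thesis using l by (simp add: second_eigenvalue_def)
next
  case False
  let ?S = "{L2_set (apply_adj V E R \<alpha>) V / L2_set \<alpha> V | \<alpha>.
                 (\<Sum>v\<in>V. \<alpha> v * 1) = 0 \<and> (\<exists>v\<in>V. \<alpha> v \<noteq> 0)}"
  obtain u where u: "u \<in> V" using V by auto
  moreover have "V \<noteq> {u}" using False by auto
  ultimately obtain w where w: "w \<in> V" "w \<noteq> u" by blast
  \<comment> \<open>\<open>cSup_least\<close> requires a nonempty set; the difference of two point
    indicators is a nonzero zero-sum vector.\<close>
  define \<delta> where "\<delta> v = (if v = u then 1 else 0) - (if v = w then 1 else (0::real))" for v
  have "(\<Sum>v\<in>V. \<delta> v) = 0" "\<delta> u \<noteq> 0" using u w V by (simp_all add: \<delta>_def sum_subtractf)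
  then have "L2_set (apply_adj V E R \<delta>) V / L2_set \<delta> V \<in> ?S" using u by auto
  then have "?S \<noteq> {}" by blast
  then have "Sup ?S \<le> l"
  proof (rule cSup_least, clarify)
    fix \<alpha> v assume \<alpha>: "(\<Sum>v\<in>V. \<alpha> v * 1) = (0::real)" and v: "v \<in> V" "\<alpha> v \<noteq> 0"
    have "L2_set \<alpha> V > 0"
      by (rule L2_set_pos[where f = \<alpha>, OF V(1) v])
    moreover have "L2_set (apply_adj V E R \<alpha>) V \<le> l * L2_set \<alpha> V"
    proof -
      have "L2_set (apply_adj V E R \<alpha>) V \<le> sqrt (l\<^sup>2 * (\<Sum>v\<in>V. (\<alpha> v)\<^sup>2))"
        unfolding L2_set_def using \<alpha> by (intro real_sqrt_le_mono bound) simp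
      then show ?thesis using l by (simp add: L2_set_def real_sqrt_mult)
    qed
    ultimately show "L2_set (apply_adj V E R \<alpha>) V / L2_set \<alpha> V \<le> l" by (simp add: divide_le_eq)
  qed
  then show ?thesis using False by (simp add: second_eigenvalue_def)
qed

section \<open>Rotation map and adjacency operator of the zig-zag product\<close>

text \<open>The new label \<open>(j', i')\<close> lists the return labels in reverse order, so a
  second application undoes the three moves from the last to the first.\<close>

lemma regular_graph_zigzag:
  assumes "regular_graph V K R1" "regular_graph K E R2"
  shows "regular_graph (V \<times> K) (E \<times> E) (zigzag R1 R2)"
proof -
  have R1: "R1 x \<in> V \<times> K \<and> R1 (R1 x) = x" if "x \<in> V \<times> K" for x
    using assms that by (auto simp: regular_graph_def)
  have R2: "R2 x \<in> K \<times> E \<and> R2 (R2 x) = x" if "x \<in> K \<times> E" for x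
    using assms that by (auto simp: regular_graph_def)
  have "zigzag R1 R2 ((v, k), (i, j)) \<in> (V \<times> K) \<times> (E \<times> E) \<and>
      zigzag R1 R2 (zigzag R1 R2 ((v, k), (i, j))) = ((v, k), (i, j))"
    if "v \<in> V" "k \<in> K" "i \<in> E" "j \<in> E" for v k i j
  proof -
    obtain k' i' where s1: "R2 (k, i) = (k', i')" by (cases "R2 (k, i)")
    then have in1: "k' \<in> K" "i' \<in> E" "R2 (k', i') = (k, i)"
      using R2[of "(k, i)"] that by auto
    obtain w l' where s2: "R1 (v, k') = (w, l')" by (cases "R1 (v, k')")
    then have in2: "w \<in> V" "l' \<in> K" "R1 (w, l') = (v, k')"
      using R1[of "(v, k')"] that in1 by auto
    obtain l j' where s3: "R2 (l', j) = (l, j')" by (cases "R2 (l', j)")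
    then have in3: "l \<in> K" "j' \<in> E" "R2 (l, j') = (l', j)"
      using R2[of "(l', j)"] that in2 by auto
    show ?thesis using s1 s2 s3 in1 in2 in3 that by (simp add: zigzag_def)
  qed
  then show ?thesis using assms by (auto simp: regular_graph_def)
qed

text \<open>The factorization \<open>B A B\<close>: the mean over label pairs is an iterated mean.
  The inner one, over \<open>j\<close>, is the small graph in the cloud reached by
  \<open>R1\<close>; the outer one, over \<open>i\<close>, is the small graph in the starting
  cloud.\<close>

lemma apply_adj_zigzag:
  assumes "regular_graph V K R1" "regular_graph K E R2" and vk: "v \<in> V" "k \<in> K"
  shows "apply_adj (V \<times> K) (E \<times> E) (zigzag R1 R2) \<alpha> (v, k) =
    apply_adj K E R2
      (\<lambda>k. case R1 (v, k) of (w, l) \<Rightarrow> apply_adj K E R2 (\<lambda>l. \<alpha> (w, l)) l) k"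
proof -
  have R1: "R1 x \<in> V \<times> K" if "x \<in> V \<times> K" for x
    using assms that by (auto simp: regular_graph_def)
  have R2: "R2 x \<in> K \<times> E" if "x \<in> K \<times> E" for x
    using assms that by (auto simp: regular_graph_def)
  have z: "(\<Sum>j\<in>E. \<alpha> (fst (zigzag R1 R2 ((v, k), (i, j))))) / card E =
     (case R1 (v, fst (R2 (k, i))) of (w, l) \<Rightarrow> apply_adj K E R2 (\<lambda>l. \<alpha> (w, l)) l)" if "i \<in> E" for i
  proof -
    obtain k' i' where s1: "R2 (k, i) = (k', i')" by (cases "R2 (k, i)")
    obtain w l where s2: "R1 (v, k') = (w, l)" by (cases "R1 (v, k')")
    have "l \<in> K" using s1 s2 R1[of "(v, k')"] R2[of "(k, i)"] vk that by auto
    then show ?thesis using s1 s2 assms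
      by (simp add: zigzag_def apply_adj_eq_mean case_prod_beta)
  qed
  have "apply_adj (V \<times> K) (E \<times> E) (zigzag R1 R2) \<alpha> (v, k) =
     (\<Sum>i\<in>E. \<Sum>j\<in>E. \<alpha> (fst (zigzag R1 R2 ((v, k), (i, j))))) / (card E * card E)"
    using vk by (subst apply_adj_eq_mean[OF regular_graph_zigzag[OF assms(1,2)]])
      (auto simp: sum.cartesian_product card_cartesian_product case_prod_beta)
  also have "\<dots> = (\<Sum>i\<in>E. (\<Sum>j\<in>E. \<alpha> (fst (zigzag R1 R2 ((v, k), (i, j))))) / card E) / card E"
    by (simp flip: sum_divide_distrib)
  also have "\<dots> = (\<Sum>i\<in>E. case R1 (v, fst (R2 (k, i))) of (w, l)
      \<Rightarrow> apply_adj K E R2 (\<lambda>l. \<alpha> (w, l)) l) / card E"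
    using z by simp
  finally show ?thesis using assms by (simp add: apply_adj_eq_mean)
qed

lemma apply_adj_cong:
  "(\<And>v. v \<in> V \<Longrightarrow> \<alpha> v = \<beta> v) \<Longrightarrow> apply_adj V E R \<alpha> u = apply_adj V E R \<beta> u"
  by (simp add: apply_adj_def)

text \<open>An average shifts along with its argument; in this form \<open>B\<close> fixes the part
  that is constant on clouds.\<close>

lemma apply_adj_add_const:
  assumes "regular_graph V E R" "u \<in> V"
  shows "apply_adj V E R (\<lambda>v. c + \<alpha> v) u = c + apply_adj V E R \<alpha> u"
proof -
  have "card E > 0" using assms by (auto simp: regular_graph_def card_gt_0_iff)
  then show ?thesis using assms by (simp add: apply_adj_eq_mean sum.distrib add_divide_distrib)
qed

section \<open>Cloud means and the orthogonal splitting\<close>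

definition mean_on :: "'k set \<Rightarrow> ('k \<Rightarrow> real) \<Rightarrow> real" where
  "mean_on K g = (\<Sum>k\<in>K. g k) / card K"

lemma sum_diff_mean_on: "finite K \<Longrightarrow> K \<noteq> {} \<Longrightarrow> (\<Sum>k\<in>K. g k - mean_on K g) = 0"
  by (simp add: mean_on_def sum_subtractf)

text \<open>Pythagoras: constants are orthogonal to zero-sum vectors, so the cross term
  \<open>2 * m * c k\<close> sums to zero.\<close>

lemma sum_square_const_add:
  fixes c :: "'k \<Rightarrow> real" and m :: real
  assumes "(\<Sum>k\<in>K. c k) = 0"
  shows "(\<Sum>k\<in>K. (m + c k)\<^sup>2) = card K * m\<^sup>2 + (\<Sum>k\<in>K. (c k)\<^sup>2)"
proof -
  have "(\<Sum>k\<in>K. (m + c k)\<^sup>2) = (\<Sum>k\<in>K. m\<^sup>2 + (c k)\<^sup>2 + 2 * m * c k)"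
    by (simp add: power2_sum)
  also have "\<dots> = card K * m\<^sup>2 + (\<Sum>k\<in>K. (c k)\<^sup>2) + 2 * m * (\<Sum>k\<in>K. c k)"
    by (simp only: sum.distrib sum_distrib_left sum_constant)
  finally show ?thesis using assms by simp
qed

lemma sum_square_mean_on:
  assumes "finite K" "K \<noteq> {}"
  shows "(\<Sum>k\<in>K. (g k)\<^sup>2) = card K * (mean_on K g)\<^sup>2 + (\<Sum>k\<in>K. (g k - mean_on K g)\<^sup>2)"
  using sum_square_const_add[OF sum_diff_mean_on[OF assms, of g], of "mean_on K g"] by simp

text \<open>Collects all that the graphs contribute as relations between four real numbers, leaving
  only real inequalities for the eigenvalue bound.\<close>

lemma zigzag_estimates:
  assumes G1: "regular_graph V K R1" and G2: "regular_graph K E R2"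
    and l1: "second_eigenvalue V K R1 \<le> l1" "0 \<le> l1"
    and l2: "second_eigenvalue K E R2 \<le> l2" "0 \<le> l2"
    and sum0: "(\<Sum>x\<in>V \<times> K. \<alpha> x) = 0"
  obtains p q H Z where "0 \<le> p" "0 \<le> q" "0 \<le> H" "0 \<le> Z"
    "(\<Sum>x\<in>V \<times> K. (\<alpha> x)\<^sup>2) = p\<^sup>2 + q\<^sup>2"
    "H + Z \<le> p\<^sup>2 + l2\<^sup>2 * q\<^sup>2"
    "sqrt H \<le> l1 * p + l2 * q"
    "(\<Sum>x\<in>V \<times> K. (apply_adj (V \<times> K) (E \<times> E) (zigzag R1 R2) \<alpha> x)\<^sup>2) \<le> H + l2\<^sup>2 * Z"
proof -
  have fin: "finite V" "finite K" "K \<noteq> {}" and D: "card K > 0"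
    and R1: "\<And>x. x \<in> V \<times> K \<Longrightarrow> R1 x \<in> V \<times> K"
    using G1 by (auto simp: regular_graph_def card_gt_0_iff)
  define D where "D = real (card K)"
  have Dpos: "D > 0" using D by (simp add: D_def)
  let ?B = "apply_adj K E R2"
  \<comment> \<open>\<open>g\<close> holds the cloud means of \<open>\<alpha>\<close>,
    \<open>b\<close> the image of the zero-sum part under the first \<open>B\<close>; then
    \<open>x\<close> is \<open>B \<alpha>\<close>, \<open>y\<close> is \<open>A x\<close>, and
    \<open>h\<close> holds the cloud means of \<open>y\<close>.\<close>
  define g where "g v = mean_on K (\<lambda>k. \<alpha> (v, k))" for v
  define b where "b v = ?B (\<lambda>k. \<alpha> (v, k) - g v)" for v
  define x where "x = (\<lambda>(v, k). g v + b v k)"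
  define y where "y v k = x (R1 (v, k))" for v k
  define h where "h v = mean_on K (y v)" for v
  \<comment> \<open>The factor \<open>D\<close> appears because a vector constant on clouds repeats
    each value \<open>D\<close> times.\<close>
  define P where "P = (\<Sum>v\<in>V. D * (g v)\<^sup>2)"
  define Q where "Q = (\<Sum>v\<in>V. \<Sum>k\<in>K. (\<alpha> (v, k) - g v)\<^sup>2)"
  define H where "H = (\<Sum>v\<in>V. D * (h v)\<^sup>2)"
  define Z where "Z = (\<Sum>v\<in>V. \<Sum>k\<in>K. (y v k - h v)\<^sup>2)"
  have nonneg: "0 \<le> P" "0 \<le> Q" "0 \<le> H" "0 \<le> Z"
    using Dpos by (auto simp: P_def Q_def H_def Z_def intro!: sum_nonneg)
  have \<alpha>_split: "(\<Sum>x\<in>V \<times> K. (\<alpha> x)\<^sup>2) = P + Q"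
    using sum_square_mean_on[OF fin(2,3), of "\<lambda>k. \<alpha> (_, k)"]
    by (simp add: P_def Q_def D_def g_def sum.distrib sum.cartesian_product')
  have y_split: "(\<Sum>v\<in>V. \<Sum>k\<in>K. (y v k)\<^sup>2) = H + Z"
    using sum_square_mean_on[OF fin(2,3), of "y _"]
    by (simp add: H_def Z_def D_def h_def sum.distrib)
  have dev0: "(\<Sum>k\<in>K. \<alpha> (v, k) - g v) = 0" for v
    unfolding g_def by (rule sum_diff_mean_on[OF fin(2,3)])
  have b0: "(\<Sum>k\<in>K. b v k) = 0" for v
    unfolding b_def using dev0 by (simp add: sum_apply_adj[OF G2])
  have b_le: "(\<Sum>v\<in>V. \<Sum>k\<in>K. (b v k)\<^sup>2) \<le> l2\<^sup>2 * Q"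
    unfolding b_def Q_def sum_distrib_left[of "l2\<^sup>2" _ V]
    by (intro sum_mono apply_adj_contracts[OF G2 l2] dev0)
  have x_split: "(\<Sum>v\<in>V. \<Sum>k\<in>K. (x (v, k))\<^sup>2) = P + (\<Sum>v\<in>V. \<Sum>k\<in>K. (b v k)\<^sup>2)"
    using sum_square_const_add[OF b0] by (simp add: x_def P_def D_def sum.distrib)
  \<comment> \<open>\<open>A\<close> only permutes coordinates, so it preserves the norm.\<close>
  have yx: "(\<Sum>v\<in>V. \<Sum>k\<in>K. (y v k)\<^sup>2) = (\<Sum>v\<in>V. \<Sum>k\<in>K. (x (v, k))\<^sup>2)"
    unfolding y_def by (rule sum_reindex_rotation[OF G1])
  have HZ: "H + Z \<le> P + l2\<^sup>2 * Q" using y_split yx x_split b_le by simp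

  \<comment> \<open>The part \<open>g\<close> of \<open>x\<close> depends on the cloud only, so its
    mean after the rotation is the large graph applied to \<open>g\<close>; \<open>h2\<close> is the
    contribution of \<open>b\<close>.\<close>
  define h1 where "h1 = apply_adj V K R1 g"
  define h2 where "h2 v = mean_on K (\<lambda>k. (\<lambda>(v, k). b v k) (R1 (v, k)))" for v
  have h: "h v = h1 v + h2 v" if "v \<in> V" for v
    using that by (simp add: h_def h1_def h2_def mean_on_def y_def x_def apply_adj_eq_mean[OF G1]
        case_prod_beta sum.distrib add_divide_distrib)
  have g0: "(\<Sum>v\<in>V. g v) = 0"
    using sum0 by (simp add: g_def mean_on_def sum.cartesian_product' flip: sum_divide_distrib)
  have h1_le: "D * (\<Sum>v\<in>V. (h1 v)\<^sup>2) \<le> l1\<^sup>2 * P"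
    using mult_left_mono[OF apply_adj_contracts[OF G1 l1 g0], of D] Dpos
    by (simp add: h1_def P_def mult.left_commute flip: sum_distrib_left)
  have h2_le: "D * (\<Sum>v\<in>V. (h2 v)\<^sup>2) \<le> l2\<^sup>2 * Q"
  proof -
    \<comment> \<open>Pythagoras on one cloud, with the nonnegative sum of squared deviations
      dropped.\<close>
    have "D * (h2 v)\<^sup>2 \<le> (\<Sum>k\<in>K. ((\<lambda>(v, k). b v k) (R1 (v, k)))\<^sup>2)" for v
      unfolding h2_def D_def by (subst sum_square_mean_on[OF fin(2,3)]) (auto intro: sum_nonneg)
    then have "D * (\<Sum>v\<in>V. (h2 v)\<^sup>2) \<le> (\<Sum>v\<in>V. \<Sum>k\<in>K. ((\<lambda>(v, k). b v k) (R1 (v, k)))\<^sup>2)"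
      by (simp add: sum_distrib_left sum_mono)
    also have "\<dots> = (\<Sum>v\<in>V. \<Sum>k\<in>K. (b v k)\<^sup>2)"
      using sum_reindex_rotation[OF G1, of "\<lambda>x. ((\<lambda>(v, k). b v k) x)\<^sup>2"] by simp
    also note b_le
    finally show ?thesis .
  qed
  \<comment> \<open>Triangle inequality for vectors of cloud means; \<open>sqrt D\<close> converts
    their norm into that of the vectors constant on clouds.\<close>
  have "sqrt H = sqrt D * L2_set h V"
    by (simp add: H_def L2_set_def real_sqrt_mult flip: sum_distrib_left)
  also have "L2_set h V = L2_set (\<lambda>v. h1 v + h2 v) V" by (rule L2_set_cong) (auto simp: h)
  also have "sqrt D * \<dots> \<le> sqrt D * (L2_set h1 V + L2_set h2 V)"
    using Dpos by (intro mult_left_mono L2_set_triangle_ineq) auto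
  also have "\<dots> = sqrt (D * (\<Sum>v\<in>V. (h1 v)\<^sup>2)) + sqrt (D * (\<Sum>v\<in>V. (h2 v)\<^sup>2))"
    by (simp add: L2_set_def real_sqrt_mult distrib_left)
  also have "\<dots> \<le> sqrt (l1\<^sup>2 * P) + sqrt (l2\<^sup>2 * Q)"
    by (intro add_mono real_sqrt_le_mono h1_le h2_le)
  also have "\<dots> = l1 * sqrt P + l2 * sqrt Q" using l1 l2 by (simp add: real_sqrt_mult)
  finally have sqrtH: "sqrt H \<le> l1 * sqrt P + l2 * sqrt Q" .

  have z0: "(\<Sum>k\<in>K. y v k - h v) = 0" for v
    unfolding h_def by (rule sum_diff_mean_on[OF fin(2,3)])
  \<comment> \<open>The last \<open>B\<close> leaves the cloud means \<open>h\<close> in place and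
    acts on the zero-sum rest, so Pythagoras applies once more.\<close>
  have M: "apply_adj (V \<times> K) (E \<times> E) (zigzag R1 R2) \<alpha> (v, k) = h v + ?B (\<lambda>k. y v k - h v) k"
    if vk: "v \<in> V" "k \<in> K" for v k
  proof -
    have "?B (\<lambda>l. \<alpha> (w, l)) l = x (w, l)" if "l \<in> K" for w l
      using apply_adj_add_const[OF G2 that, of "g w" "\<lambda>l. \<alpha> (w, l) - g w"]
      by (simp add: x_def b_def)
    then have "(case R1 (v, k) of (w, l) \<Rightarrow> ?B (\<lambda>l. \<alpha> (w, l)) l) = h v + (y v k - h v)"
      if "k \<in> K" for k
      using R1[of "(v, k)"] vk that by (auto simp: y_def split: prod.splits)
    then have "?B (\<lambda>k. case R1 (v, k) of (w, l) \<Rightarrow> ?B (\<lambda>l. \<alpha> (w, l)) l) k =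
        ?B (\<lambda>k. h v + (y v k - h v)) k"
      by (rule apply_adj_cong)
    then show ?thesis
      by (simp only: apply_adj_zigzag[OF G1 G2 vk] apply_adj_add_const[OF G2 vk(2)])
  qed
  have "(\<Sum>x\<in>V \<times> K. (apply_adj (V \<times> K) (E \<times> E) (zigzag R1 R2) \<alpha> x)\<^sup>2) =
      (\<Sum>v\<in>V. \<Sum>k\<in>K. (h v + ?B (\<lambda>k. y v k - h v) k)\<^sup>2)"
    using M by (simp add: sum.cartesian_product')
  also have "\<dots> = H + (\<Sum>v\<in>V. \<Sum>k\<in>K. (?B (\<lambda>k. y v k - h v) k)\<^sup>2)"
    using z0 by (simp add: sum_square_const_add sum_apply_adj[OF G2] sum.distrib H_def D_def)
  also have "\<dots> \<le> H + l2\<^sup>2 * Z"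
    unfolding Z_def sum_distrib_left[of "l2\<^sup>2" _ V]
    by (intro add_left_mono sum_mono apply_adj_contracts[OF G2 l2] z0)
  finally have out: "(\<Sum>x\<in>V \<times> K. (apply_adj (V \<times> K) (E \<times> E) (zigzag R1 R2) \<alpha> x)\<^sup>2)
      \<le> H + l2\<^sup>2 * Z" .
  show thesis
    by (rule that[of "sqrt P" "sqrt Q" H Z]) (use nonneg \<alpha>_split HZ sqrtH out in auto)
qed

section \<open>The bounding function and its real inequalities\<close>

text \<open>The linear expression can reach 1 although both arguments are below 1, hence the minimum
  with a root that stays below 1; the argument for the root relies on \<open>l1 < 1\<close> and
  \<open>l2 < 1\<close>.\<close>

definition zigzag_bound :: "real \<Rightarrow> real \<Rightarrow> real" where
  "zigzag_bound l1 l2 =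
     (if l1 < 1 \<and> l2 < 1
      then min (l1 + l2 + l2\<^sup>2) (sqrt (1 - (1 - l2\<^sup>2) * ((1 - l1) / 2)\<^sup>2))
      else l1 + l2 + l2\<^sup>2)"

lemma zigzag_bound_le: "zigzag_bound l1 l2 \<le> l1 + l2 + l2\<^sup>2"
  by (simp add: zigzag_bound_def)

text \<open>Both factors lie in the half-open interval from 0 to 1, with 0 excluded. This puts the
  radicand in \<open>zigzag_bound\<close> between 0 and 1, strictly below 1.\<close>

lemma zigzag_gap:
  fixes l1 l2 :: real
  assumes "0 \<le> l1" "0 \<le> l2" "l1 < 1" "l2 < 1"
  shows "0 < (1 - l2\<^sup>2) * ((1 - l1) / 2)\<^sup>2" "(1 - l2\<^sup>2) * ((1 - l1) / 2)\<^sup>2 \<le> 1"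
proof -
  have "l2\<^sup>2 < 1" using assms by (simp add: power_less_one_iff)
  then show "0 < (1 - l2\<^sup>2) * ((1 - l1) / 2)\<^sup>2" using assms by simp
  have "((1 - l1) / 2)\<^sup>2 \<le> 1" using assms by (intro power_le_one) auto
  then show "(1 - l2\<^sup>2) * ((1 - l1) / 2)\<^sup>2 \<le> 1"
    using \<open>l2\<^sup>2 < 1\<close> by (intro mult_le_one) auto
qed

lemma zigzag_bound_less_1:
  assumes "0 \<le> l1" "0 \<le> l2" "l1 < 1" "l2 < 1"
  shows "zigzag_bound l1 l2 < 1"
  using assms zigzag_gap[OF assms] by (simp add: zigzag_bound_def min_less_iff_disj)

lemma zigzag_bound_nonneg:
  assumes "0 \<le> l1" "0 \<le> l2"
  shows "0 \<le> zigzag_bound l1 l2"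
  using assms zigzag_gap[OF assms] by (auto simp: zigzag_bound_def)

text \<open>\<open>H\<close> is bounded by the square of the linear estimate and \<open>Z\<close> by
  the norm estimate. The resulting coefficient
  \<open>l1\<^sup>2 + l1 * l2 + l2\<^sup>2 + (l2\<^sup>2)\<^sup>2\<close> is a part of the expanded
  square of \<open>l1 + l2 + l2\<^sup>2\<close>, whose other terms are nonnegative.\<close>

lemma linear_bound_square:
  fixes p q H Z l1 l2 :: real
  assumes "0 \<le> l1" "0 \<le> l2" "0 \<le> p" "0 \<le> q" "0 \<le> H"
    and HZ: "H + Z \<le> p\<^sup>2 + l2\<^sup>2 * q\<^sup>2" and H: "sqrt H \<le> l1 * p + l2 * q"
  shows "H + l2\<^sup>2 * Z \<le> (l1 + l2 + l2\<^sup>2)\<^sup>2 * (p\<^sup>2 + q\<^sup>2)"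
proof -
  have "H \<le> (l1 * p + l2 * q)\<^sup>2" using H assms by (simp add: sqrt_le_D)
  moreover have "l2\<^sup>2 * Z \<le> l2\<^sup>2 * (p\<^sup>2 + l2\<^sup>2 * q\<^sup>2)" using HZ assms by (intro mult_left_mono) auto
  ultimately have "H + l2\<^sup>2 * Z \<le> (l1 * p + l2 * q)\<^sup>2 + l2\<^sup>2 * (p\<^sup>2 + l2\<^sup>2 * q\<^sup>2)" by simp
  also have "\<dots> = l1\<^sup>2 * p\<^sup>2 + l1 * l2 * (2 * p * q) + l2\<^sup>2 * (p\<^sup>2 + q\<^sup>2) + (l2\<^sup>2)\<^sup>2 * q\<^sup>2"
    by (simp add: power2_eq_square algebra_simps)
  \<comment> \<open>The mixed term uses \<open>2 * p * q \<le> p\<^sup>2 + q\<^sup>2\<close>;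
    elsewhere a single square is enlarged to the sum of both.\<close>
  also have "\<dots> \<le> l1\<^sup>2 * (p\<^sup>2 + q\<^sup>2) + l1 * l2 * (p\<^sup>2 + q\<^sup>2) + l2\<^sup>2 * (p\<^sup>2 + q\<^sup>2)
      + (l2\<^sup>2)\<^sup>2 * (p\<^sup>2 + q\<^sup>2)"
    using assms by (intro add_mono mult_left_mono sum_squares_bound) auto
  also have "\<dots> = (l1\<^sup>2 + l1 * l2 + l2\<^sup>2 + (l2\<^sup>2)\<^sup>2) * (p\<^sup>2 + q\<^sup>2)"
    by (simp add: algebra_simps)
  also have "\<dots> \<le> (l1 + l2 + l2\<^sup>2)\<^sup>2 * (p\<^sup>2 + q\<^sup>2)"
    using assms by (intro mult_right_mono) (auto simp: power2_eq_square algebra_simps)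
  finally show ?thesis .
qed

text \<open>If \<open>q\<close> is small compared with \<open>\<surd>(p\<^sup>2 + q\<^sup>2)\<close>, the middle step loses through \<open>H\<close>; otherwise the
  first application of the small graph already shrinks the vector.\<close>

lemma gap_bound_square:
  fixes p q H Z l1 l2 :: real
  assumes "0 \<le> l1" "0 \<le> l2" "l1 < 1" "l2 < 1" "0 \<le> p" "0 \<le> q" "0 \<le> H" "0 \<le> Z"
    and HZ: "H + Z \<le> p\<^sup>2 + l2\<^sup>2 * q\<^sup>2" and H: "sqrt H \<le> l1 * p + l2 * q"
  shows "H + l2\<^sup>2 * Z \<le> (1 - (1 - l2\<^sup>2) * ((1 - l1) / 2)\<^sup>2) * (p\<^sup>2 + q\<^sup>2)"
proof -
  \<comment> \<open>Half the gap of the large graph, chosen so that \<open>l1 + d = 1 - d\<close>: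
    if \<open>q \<le> d * n\<close>, then \<open>sqrt H\<close> still loses the factor
    \<open>1 - d\<close>.\<close>
  define d where "d = (1 - l1) / 2"
  define n where "n = sqrt (p\<^sup>2 + q\<^sup>2)"
  have d: "0 < d" "d \<le> 1" "l1 = 1 - 2 * d" using assms by (auto simp: d_def field_simps)
  have n: "0 \<le> n" "n\<^sup>2 = p\<^sup>2 + q\<^sup>2" "p \<le> n" by (auto simp: n_def)
  have l2: "l2\<^sup>2 < 1" using assms by (simp add: power_less_one_iff)
  have "H + l2\<^sup>2 * Z \<le> (1 - (1 - l2\<^sup>2) * d\<^sup>2) * n\<^sup>2"
  proof (cases "q \<le> d * n")
    case True
    have "l1 * p + l2 * q \<le> l1 * n + 1 * (d * n)"
      using assms True n by (intro add_mono mult_mono) auto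
    also have "\<dots> = (1 - d) * n" by (simp add: d(3) algebra_simps)
    finally have "sqrt H \<le> (1 - d) * n" using H by linarith
    then have H': "H \<le> (1 - d)\<^sup>2 * n\<^sup>2" using sqrt_le_D by (fastforce simp: power_mult_distrib)
    have "l2\<^sup>2 * q\<^sup>2 \<le> q\<^sup>2" using l2 by (simp add: mult_left_le_one_le)
    then have "H + Z \<le> n\<^sup>2" using HZ n by linarith
    \<comment> \<open>\<open>H + l2\<^sup>2 * Z\<close> equals
      \<open>(1 - l2\<^sup>2) * H + l2\<^sup>2 * (H + Z)\<close>, so the bounds on \<open>H\<close>
      and on \<open>H + Z\<close> enter as a convex combination.\<close>
    then have "H + l2\<^sup>2 * Z \<le> (1 - l2\<^sup>2) * H + l2\<^sup>2 * n\<^sup>2"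
      using mult_left_mono[of "H + Z" "n\<^sup>2" "l2\<^sup>2"] by (simp add: algebra_simps)
    also have "\<dots> \<le> (1 - l2\<^sup>2) * ((1 - d)\<^sup>2 * n\<^sup>2) + l2\<^sup>2 * n\<^sup>2"
      using H' l2 by (intro add_right_mono mult_left_mono) auto
    also have "\<dots> = (1 - (1 - l2\<^sup>2) * (1 - (1 - d)\<^sup>2)) * n\<^sup>2"
      by (simp add: algebra_simps)
    also have "\<dots> \<le> (1 - (1 - l2\<^sup>2) * d\<^sup>2) * n\<^sup>2"
    proof -
      \<comment> \<open>The loss \<open>1 - (1 - d)\<^sup>2\<close> is
        \<open>2 * d - d\<^sup>2\<close>; weakening it to \<open>d\<^sup>2\<close> matches the other
        case.\<close>
      have "d * d \<le> d * 1" using d by (intro mult_left_mono) auto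
      then have "d\<^sup>2 \<le> 1 - (1 - d)\<^sup>2" by (simp add: power2_eq_square algebra_simps)
      then show ?thesis using l2 by (intro mult_right_mono diff_left_mono mult_left_mono) auto
    qed
    finally show ?thesis .
  next
    case False
    then have "(d * n)\<^sup>2 \<le> q\<^sup>2" using d n by (intro power_mono) auto
    then have dq: "(1 - l2\<^sup>2) * (d\<^sup>2 * n\<^sup>2) \<le> (1 - l2\<^sup>2) * q\<^sup>2"
      using l2 by (intro mult_left_mono) (auto simp: power_mult_distrib)
    have "l2\<^sup>2 * Z \<le> Z" using l2 assms by (simp add: mult_left_le_one_le)
    then have "H + l2\<^sup>2 * Z \<le> p\<^sup>2 + l2\<^sup>2 * q\<^sup>2" using HZ by linarith
    also have "\<dots> = n\<^sup>2 - (1 - l2\<^sup>2) * q\<^sup>2" by (simp add: n algebra_simps)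
    also have "\<dots> \<le> n\<^sup>2 - (1 - l2\<^sup>2) * (d\<^sup>2 * n\<^sup>2)" using dq by simp
    finally show ?thesis by (simp add: algebra_simps)
  qed
  then show ?thesis by (simp add: d_def n)
qed

lemma expander_graph_zigzag:
  assumes "0 \<le> l1" "0 \<le> l2"
    and G1: "expander_graph V K R1 N1 D1 l1" and G2: "expander_graph K E R2 D1 D2 l2"
  shows "expander_graph (V \<times> K) (E \<times> E) (zigzag R1 R2) (N1 * D1) (D2\<^sup>2) (zigzag_bound l1 l2)"
proof -
  have reg: "regular_graph V K R1" "regular_graph K E R2"
    and ev: "second_eigenvalue V K R1 \<le> l1" "second_eigenvalue K E R2 \<le> l2"
    and card: "card V = N1" "card K = D1" "card E = D2"
    using G1 G2 by (auto simp: expander_graph_def)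
  have "second_eigenvalue (V \<times> K) (E \<times> E) (zigzag R1 R2) \<le> zigzag_bound l1 l2"
  proof (rule second_eigenvalue_leI)
    show "finite (V \<times> K)" "V \<times> K \<noteq> {}" using reg by (auto simp: regular_graph_def)
    show "0 \<le> zigzag_bound l1 l2" by (rule zigzag_bound_nonneg[OF assms(1,2)])
    fix \<alpha> :: "'a \<times> 'b \<Rightarrow> real" assume "(\<Sum>v\<in>V \<times> K. \<alpha> v) = 0"
    from zigzag_estimates[OF reg ev(1) assms(1) ev(2) assms(2) this]
    obtain p q H Z where e: "0 \<le> p" "0 \<le> q" "0 \<le> H" "0 \<le> Z"
      "(\<Sum>x\<in>V \<times> K. (\<alpha> x)\<^sup>2) = p\<^sup>2 + q\<^sup>2"
      "H + Z \<le> p\<^sup>2 + l2\<^sup>2 * q\<^sup>2" "sqrt H \<le> l1 * p + l2 * q"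
      "(\<Sum>x\<in>V \<times> K. (apply_adj (V \<times> K) (E \<times> E) (zigzag R1 R2) \<alpha> x)\<^sup>2) \<le> H + l2\<^sup>2 * Z" .
    have "H + l2\<^sup>2 * Z \<le> (zigzag_bound l1 l2)\<^sup>2 * (p\<^sup>2 + q\<^sup>2)"
    proof -
      \<comment> \<open>A minimum is attained by one of its arguments, so each case invokes just the
        matching inequality.\<close>
      consider "zigzag_bound l1 l2 = l1 + l2 + l2\<^sup>2"
        | "l1 < 1" "l2 < 1" "zigzag_bound l1 l2 = sqrt (1 - (1 - l2\<^sup>2) * ((1 - l1) / 2)\<^sup>2)"
        unfolding zigzag_bound_def min_def by metis
      then show ?thesis
      proof cases
        case 1
        then show ?thesis using linear_bound_square[OF assms(1,2) e(1,2,3,6,7)] by simp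
      next
        case 2
        then show ?thesis using gap_bound_square[OF assms(1,2) 2(1,2) e(1-4,6,7)]
            zigzag_gap[OF assms(1,2) 2(1,2)] by simp
      qed
    qed
    then show "(\<Sum>v\<in>V \<times> K. (apply_adj (V \<times> K) (E \<times> E) (zigzag R1 R2) \<alpha> v)\<^sup>2)
        \<le> (zigzag_bound l1 l2)\<^sup>2 * (\<Sum>v\<in>V \<times> K. (\<alpha> v)\<^sup>2)"
      unfolding e(5) by (rule order_trans[OF e(8)])
  qed
  then show ?thesis
    using regular_graph_zigzag[OF reg] card
    by (simp add: expander_graph_def card_cartesian_product power2_eq_square)
qed

section \<open>The Turing machine\<close>

lemma run_trans:
  "run M f1 f2 c t q1 q2 c' \<Longrightarrow> run M f1 f2 c' t' q1' q2' c'' \<Longrightarrow>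
   run M f1 f2 c (t + t') (q1 + q1') (q2 + q2') c''"
  by (induction rule: run.induct) (auto intro: run.intros)

text \<open>Projections replace the pair equation of \<open>run.step\<close>, so the rule applies
  backwards without naming the next state and actions.\<close>

lemma run_step:
  assumes "q < length (prog M)" "prog M ! q = Step \<delta>"
    and "run M f1 f2 (fst (\<delta> (scanned ts)), act (snd (\<delta> (scanned ts))) ts) t q1 q2 c"
  shows "run M f1 f2 (q, ts) (Suc t) q1 q2 c"
  using assms by (intro run.step[where \<delta> = \<delta>]) auto

lemma run_cong:
  "run M f1 f2 c t q1 q2 c' \<Longrightarrow> t = t' \<Longrightarrow> q1 = q1' \<Longrightarrow> q2 = q2' \<Longrightarrow>
   run M f1 f2 c t' q1' q2' c'"
  by simp

section \<open>Tapes carrying words, and the effect of single steps\<close>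

text \<open>Contents and head are kept apart, since the head moves over a word that stays at cell 0.
  The head is an integer because rewinding visits cell -1.\<close>

definition tape_at :: "sym list \<Rightarrow> int \<Rightarrow> tape" where
  "tape_at w h = (fst (tape_of w), h)"

lemma tape_of_eq: "tape_of w = tape_at w 0"
  by (simp add: tape_at_def tape_of_def)

lemma word_of_tape_at:
  assumes "Blank \<notin> set w"
  shows "word_of (tape_at w h) = w"
proof -
  have "(LEAST n. fst (tape_at w h) (int n) = Blank) = length w"
  proof (rule Least_equality)
    show "fst (tape_at w h) (int (length w)) = Blank"
      by (simp add: tape_at_def tape_of_def)
    fix n assume blank: "fst (tape_at w h) (int n) = Blank"
    show "length w \<le> n"
    proof (rule ccontr)
      assume "\<not> length w \<le> n"
      then have "w ! n = Blank" using blank by (simp add: tape_at_def tape_of_def)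
      then show False using assms \<open>\<not> length w \<le> n\<close> by (metis not_le nth_mem)
    qed
  qed
  then show ?thesis
    by (auto simp: word_of_def tape_at_def tape_of_def intro: nth_equalityI)
qed

lemma scanned_nth: "n < length ts \<Longrightarrow> scanned ts ! n = fst (ts ! n) (snd (ts ! n))"
  by (simp add: scanned_def case_prod_beta)

lemma length_scanned [simp]: "length (scanned ts) = length ts"
  by (simp add: scanned_def)

definition write_move :: "sym \<Rightarrow> move \<Rightarrow> tape \<Rightarrow> tape" where
  "write_move s m t = ((fst t)(snd t := s), snd t + offset m)"

lemma length_act [simp]: "length as = length ts \<Longrightarrow> length (act as ts) = length ts"
  by (simp add: act_def)

lemma act_nth:
  "length as = length ts \<Longrightarrow> n < length ts \<Longrightarrow>
   act as ts ! n = write_move (fst (as ! n)) (snd (as ! n)) (ts ! n)"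
  by (simp add: act_def write_move_def case_prod_beta)

text \<open>The neutral action list; a program overrides individual tapes by list update.\<close>

definition idle :: "sym list \<Rightarrow> (sym \<times> move) list" where
  "idle xs = map (\<lambda>s. (s, Stay)) xs"

lemma length_idle [simp]: "length (idle xs) = length xs"
  by (simp add: idle_def)

lemma act_idle: "act (idle (scanned ts)) ts = ts"
  by (rule nth_equalityI) (auto simp: act_nth idle_def scanned_nth write_move_def)

text \<open>Actions on different tapes are independent, so each override can be evaluated on its own
  until \<open>act_idle\<close> finishes.\<close>

lemma act_update:
  "length as = length ts \<Longrightarrow> n < length ts \<Longrightarrow>
   act (as[n := (s, m)]) ts = (act as ts)[n := write_move s m (ts ! n)]"
  by (rule nth_equalityI) (auto simp: act_nth nth_list_update)

lemma write_move_same: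
  "write_move (fst (tape_at w h) h) m (tape_at w h) = tape_at w (h + offset m)"
  by (simp add: write_move_def tape_at_def)

lemma write_move_append:
  "write_move s Right (tape_at w (int (length w))) = tape_at (w @ [s]) (int (length (w @ [s])))"
  by (auto simp: write_move_def tape_at_def tape_of_def nth_append fun_eq_iff nat_eq_iff)

text \<open>In \<open>copy_action\<close> and \<open>rewind_actions\<close>, the argument \<open>q\<close> is the index of the (first) state itself.\<close>

definition copy_action :: "nat \<Rightarrow> nat \<Rightarrow> nat \<Rightarrow> action" where
  "copy_action q a b = Step (\<lambda>xs.
     (if xs ! a = Sep then Suc q else q, (idle xs)[a := (xs ! a, Right), b := (xs ! a, Right)]))"

text \<open>The rest of the run is a premise, so one rule serves both the loop in state
  \<open>q\<close> and the exit on \<open>Sep\<close>.\<close>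

lemma run_copy_step:
  assumes "q < length (prog M)" "prog M ! q = copy_action q a b"
    and ab: "a < length ts" "b < length ts" "a \<noteq> b"
    and a: "ts ! a = tape_at (x @ s # y) (int (length x))"
    and b: "ts ! b = tape_at u (int (length u))"
    and r: "run M f1 f2 (if s = Sep then Suc q else q,
       ts[a := tape_at (x @ s # y) (int (length (x @ [s]))),
          b := tape_at (u @ [s]) (int (length (u @ [s])))]) t q1 q2 c"
  shows "run M f1 f2 (q, ts) (Suc t) q1 q2 c"
proof -
  have s: "fst (tape_at (x @ s # y) (int (length x))) (int (length x)) = s"
    by (simp add: tape_at_def tape_of_def)
  have sc: "scanned ts ! a = s"
    using ab s by (simp add: scanned_nth a) (simp add: tape_at_def)
  have wa: "write_move s Right (ts ! a) = tape_at (x @ s # y) (int (length (x @ [s])))"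
    using write_move_same[of "x @ s # y" "int (length x)" Right] s by (simp add: a add.commute)
  have "act ((idle (scanned ts))[a := (s, Right), b := (s, Right)]) ts =
      ts[a := tape_at (x @ s # y) (int (length (x @ [s]))),
         b := tape_at (u @ [s]) (int (length (u @ [s])))]"
    using ab by (simp only: act_update length_idle length_scanned length_list_update act_idle wa)
      (simp only: b write_move_append)
  then show ?thesis
    using assms(1) r sc
    by (intro run_step[OF _ assms(2)[unfolded copy_action_def]]) (auto split: if_splits)
qed

text \<open>Induction on the uncopied word: each step moves one symbol into the prefixes
  \<open>x\<close> and \<open>u\<close>. The separator is copied too, which accounts for the
  \<open>Suc\<close> in the time.\<close>

lemma run_copy_word:
  assumes q: "q < length (prog M)" "prog M ! q = copy_action q a b"
    and ab: "a < length ts" "b < length ts" "a \<noteq> b"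
    and "Sep \<notin> set w"
    and "ts ! a = tape_at (x @ w @ Sep # y) (int (length x))"
    and "ts ! b = tape_at u (int (length u))"
  shows "run M f1 f2 (q, ts) (Suc (length w)) 0 0
     (Suc q, ts[a := tape_at (x @ w @ Sep # y) (int (length (x @ w @ [Sep]))),
                b := tape_at (u @ w @ [Sep]) (int (length (u @ w @ [Sep])))])"
  using assms(3-)
proof (induction w arbitrary: x u ts)
  case Nil
  then show ?case
    by (intro run_copy_step[OF q, where x = x and y = y and u = u and s = Sep])
      (auto intro: run.refl)
next
  case (Cons s w)
  let ?ts = "ts[a := tape_at (x @ (s # w) @ Sep # y) (int (length (x @ [s]))),
                b := tape_at (u @ [s]) (int (length (u @ [s])))]"
  have "run M f1 f2 (q, ?ts) (Suc (length w)) 0 0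
     (Suc q, ?ts[a := tape_at ((x @ [s]) @ w @ Sep # y) (int (length ((x @ [s]) @ w @ [Sep]))),
                b := tape_at ((u @ [s]) @ w @ [Sep]) (int (length ((u @ [s]) @ w @ [Sep])))])"
    using Cons.prems by (intro Cons.IH) (auto simp: nth_list_update)
  moreover have "?ts[a := tape_at ((x @ [s]) @ w @ Sep # y) (int (length ((x @ [s]) @ w @ [Sep]))),
                b := tape_at ((u @ [s]) @ w @ [Sep]) (int (length ((u @ [s]) @ w @ [Sep])))] =
     ts[a := tape_at (x @ (s # w) @ Sep # y) (int (length (x @ (s # w) @ [Sep]))),
        b := tape_at (u @ (s # w) @ [Sep]) (int (length (u @ (s # w) @ [Sep])))]"
    using Cons.prems by (intro nth_equalityI) (auto simp: nth_list_update)
  ultimately show ?case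
    using Cons.prems
    by (intro run_copy_step[OF q, where x = x and y = "w @ Sep # y" and u = u and s = s]) auto
qed

text \<open>The first state leaves the blank behind the word, the second one stops at the blank in front
  of it.\<close>

definition rewind_actions :: "nat \<Rightarrow> nat \<Rightarrow> action list" where
  "rewind_actions q a =
     [Step (\<lambda>xs. (Suc q, (idle xs)[a := (xs ! a, Left)])),
      Step (\<lambda>xs. if xs ! a = Blank then (Suc (Suc q), (idle xs)[a := (xs ! a, Right)])
                 else (Suc q, (idle xs)[a := (xs ! a, Left)]))]"

lemma act_shift:
  assumes "a < length ts" "ts ! a = tape_at w h"
  shows "act ((idle (scanned ts))[a := (scanned ts ! a, m)]) ts = ts[a := tape_at w (h + offset m)]"
proof -
  have "scanned ts ! a = fst (tape_at w h) h"
    using assms by (simp add: scanned_nth) (simp add: tape_at_def)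
  then show ?thesis using assms by (simp add: act_update act_idle write_move_same)
qed

lemma run_rewind:
  assumes q: "Suc q < length (prog M)" "[prog M ! q, prog M ! Suc q] = rewind_actions q a"
    and a: "a < length ts" "ts ! a = tape_at w (int (length w))" and w: "Blank \<notin> set w"
  shows "run M f1 f2 (q, ts) (length w + 2) 0 0 (Suc (Suc q), ts[a := tape_at w 0])"
proof -
  have q1: "prog M ! q = Step (\<lambda>xs. (Suc q, (idle xs)[a := (xs ! a, Left)]))"
    and q2: "prog M ! Suc q = Step (\<lambda>xs. if xs ! a = Blank
      then (Suc (Suc q), (idle xs)[a := (xs ! a, Right)])
      else (Suc q, (idle xs)[a := (xs ! a, Left)]))"
    using q(2) by (auto simp: rewind_actions_def)
  \<comment> \<open>Head position \<open>n - 1\<close> means that \<open>n\<close> symbols remain to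
    be passed. At \<open>n = 0\<close> the head is on the blank cell -1 and turns back to cell 0;
    with the initial step the total is \<open>length w + 2\<close>.\<close>
  have loop: "run M f1 f2 (Suc q, ts) (Suc n) 0 0 (Suc (Suc q), ts[a := tape_at w 0])"
    if "n \<le> length w" "a < length ts" "ts ! a = tape_at w (int n - 1)" for n ts
    using that
  proof (induction n arbitrary: ts)
    case 0
    have sc: "scanned ts ! a = Blank"
      using 0 by (simp add: scanned_nth) (simp add: tape_at_def tape_of_def)
    have "act ((idle (scanned ts))[a := (Blank, Right)]) ts = ts[a := tape_at w 0]"
      using act_shift[OF 0(2,3), of Right] sc by simp
    then show ?case
      using q sc by (intro run_step[OF q(1) q2]) (auto intro: run.refl)
  next
    case (Suc n)
    have sc: "scanned ts ! a = w ! n"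
      using Suc.prems by (simp add: scanned_nth) (simp add: tape_at_def tape_of_def)
    have "w ! n \<noteq> Blank" using w Suc.prems by (metis Suc_le_eq nth_mem)
    moreover have "act ((idle (scanned ts))[a := (w ! n, Left)]) ts =
        ts[a := tape_at w (int n - 1)]"
      using act_shift[OF Suc.prems(2,3), of Left] sc by simp
    moreover have "run M f1 f2 (Suc q, ts[a := tape_at w (int n - 1)]) (Suc n) 0 0
        (Suc (Suc q), ts[a := tape_at w 0])"
      using Suc.IH[of "ts[a := tape_at w (int n - 1)]"] Suc.prems by simp
    ultimately show ?case
      using q sc by (intro run_step[OF q(1) q2]) auto
  qed
  have act: "act ((idle (scanned ts))[a := (scanned ts ! a, Left)]) ts =
      ts[a := tape_at w (int (length w) - 1)]"
    using act_shift[OF a, of Left] by simp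
  have "run M f1 f2 (Suc q, ts[a := tape_at w (int (length w) - 1)]) (Suc (length w)) 0 0
      (Suc (Suc q), ts[a := tape_at w 0])"
    using loop[of "length w" "ts[a := tape_at w (int (length w) - 1)]"] a by simp
  then have "run M f1 f2 (q, ts) (Suc (Suc (length w))) 0 0 (Suc (Suc q), ts[a := tape_at w 0])"
    using q act by (intro run_step[OF _ q1]) auto
  then show ?thesis by simp
qed

section \<open>Lengths of encodings\<close>

lemma set_bits: "set (bits n) \<subseteq> {Zero, One}"
proof (induction n rule: bits.induct)
  case (1 n)
  then show ?case by (subst bits.simps) auto
qed

text \<open>Halving removes one digit and lowers the logarithm by at least 1, the rounding in
  \<open>n div 2\<close> going the right way.\<close>

lemma length_bits_le: "n \<ge> 1 \<Longrightarrow> real (length (bits n)) \<le> log 2 (real n) + 1"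
proof (induction n rule: less_induct)
  case (less n)
  show ?case
  proof (cases "n = 1")
    case True
    then show ?thesis by (simp add: bits.simps)
  next
    case False
    with less have n: "n \<ge> 2" by simp
    then have "n div 2 \<ge> 1" "n div 2 < n" by auto
    then have "real (length (bits (n div 2))) \<le> log 2 (real (n div 2)) + 1" by (intro less)
    also have "log 2 (real (n div 2)) \<le> log 2 (real n / 2)"
      using \<open>n div 2 \<ge> 1\<close> of_nat_div_le_of_nat[of n 2, where 'a = real] by (intro log_mono) auto
    also have "\<dots> = log 2 (real n) - 1" using n by (subst log_divide) auto
    finally show ?thesis using n by (subst bits.simps) simp
  qed
qed

text \<open>Both the code length of \<open>n\<close> with its separator and the exact number of
  steps that copy it.\<close>

definition cost :: "nat \<Rightarrow> nat" where
  "cost n = Suc (length (bits n))"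

lemma cost_le:
  assumes "1 \<le> n" "n \<le> N"
  shows "real (cost n) \<le> log 2 (real N) + 2"
proof -
  have "log 2 (real n) \<le> log 2 (real N)" using assms by (intro log_mono) auto
  then show ?thesis using length_bits_le[OF assms(1)] by (simp add: cost_def)
qed

lemma encode_simps [simp]:
  "encode [] = []" "encode (n # ns) = bits n @ Sep # encode ns"
  "encode (ms @ ns) = encode ms @ encode ns"
  by (simp_all add: encode_def)

lemma length_encode: "length (encode ns) = sum_list (map cost ns)"
  by (induction ns) (auto simp: cost_def)

lemma Blank_notin_encode: "Blank \<notin> set (encode ns)"
proof (induction ns)
  case (Cons n ns)
  then show ?case using set_bits[of n] by auto
qed simp

section \<open>Tapes carrying lists of numbers\<close>

text \<open>The head stands at the start of the number with zero-based index \<open>k\<close>, or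
  just behind the word when \<open>k = length ns\<close>, ready to append.\<close>

definition nums_tape :: "nat list \<Rightarrow> nat \<Rightarrow> tape" where
  "nums_tape ns k = tape_at (encode ns) (int (length (encode (take k ns))))"

lemma tape_of_encode: "tape_of (encode ns) = nums_tape ns 0"
  by (simp add: tape_of_eq nums_tape_def)

lemma word_of_nums_tape: "word_of (nums_tape ns k) = encode ns"
  by (simp add: nums_tape_def word_of_tape_at Blank_notin_encode)

text \<open>Digits never contain \<open>Sep\<close>, so copying from index \<open>k\<close> ends
  exactly at the separator of that number.\<close>

lemma run_copy:
  assumes "q < length (prog M)" "prog M ! q = copy_action q a b"
    and "a < length ts" "b < length ts" "a \<noteq> b"
    and k: "k < length ns" and a: "ts ! a = nums_tape ns k"
    and b: "ts ! b = nums_tape ms (length ms)"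
  shows "run M f1 f2 (q, ts) (cost (ns ! k)) 0 0
     (Suc q, ts[a := nums_tape ns (Suc k), b := nums_tape (ms @ [ns ! k]) (Suc (length ms))])"
proof -
  have ns: "encode ns = encode (take k ns) @ bits (ns ! k) @ Sep # encode (drop (Suc k) ns)"
    by (subst id_take_nth_drop[OF k]) simp
  have "Sep \<notin> set (bits (ns ! k))" using set_bits[of "ns ! k"] by auto
  from run_copy_word[OF assms(1-5) this, where x = "encode (take k ns)"
      and y = "encode (drop (Suc k) ns)" and u = "encode ms"]
  show ?thesis
    using a b k ns by (simp add: nums_tape_def cost_def take_Suc_conv_app_nth)
qed

lemma run_rewind_nums:
  assumes "Suc q < length (prog M)" "[prog M ! q, prog M ! Suc q] = rewind_actions q a"
    and "a < length ts" "ts ! a = nums_tape ns (length ns)"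
  shows "run M f1 f2 (q, ts) (sum_list (map cost ns) + 2) 0 0
    (Suc (Suc q), ts[a := nums_tape ns 0])"
  using run_rewind[OF assms(1-3), of "encode ns"] assms(4) Blank_notin_encode[of ns]
  by (simp add: nums_tape_def length_encode)

text \<open>A query leaves an empty query tape and an answer with its head at the start, so copying
  can go on at once. The query is read regardless of its head position, hence the arbitrary
  \<open>k\<close>.\<close>

lemma run_ask1:
  assumes "q < length (prog M)" "prog M ! q = Ask1 q'"
    and "ts ! 1 = nums_tape ns k" "f1 (encode ns) = encode ms"
  shows "run M f1 f2 (q, ts) 1 1 0 (q', ts[1 := nums_tape [] 0, 2 := nums_tape ms 0])"
  using run.ask1[OF assms(1,2) run.refl, of f1 f2 ts] assms(3,4) tape_of_encode[of "[]"]
  by (simp add: consult_def word_of_nums_tape tape_of_encode)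

lemma run_ask2:
  assumes "q < length (prog M)" "prog M ! q = Ask2 q'"
    and "ts ! 1 = nums_tape ns k" "f2 (encode ns) = encode ms"
  shows "run M f1 f2 (q, ts) 1 0 1 (q', ts[1 := nums_tape [] 0, 2 := nums_tape ms 0])"
  using run.ask2[OF assms(1,2) run.refl, of f1 f2 ts] assms(3,4) tape_of_encode[of "[]"]
  by (simp add: consult_def word_of_nums_tape tape_of_encode)

text \<open>Tapes 4 and 5 keep \<open>v\<close> and \<open>i'\<close> while the query and answer tapes are overwritten;
  tape 6 receives the unused parameters \<open>N1\<close>, \<open>D1\<close>, \<open>D2\<close>.\<close>

definition zigzag_prog :: "action list" where
  "zigzag_prog =
     [copy_action 0 0 6, copy_action 1 0 6, copy_action 2 0 6, copy_action 3 0 4] @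
     rewind_actions 4 4 @
     [copy_action 6 0 1, copy_action 7 0 1, Ask2 9,
      copy_action 9 4 1, copy_action 10 2 1, copy_action 11 2 5] @
     rewind_actions 12 5 @
     [Ask1 15, copy_action 15 2 3, copy_action 16 2 1, copy_action 17 0 1, Ask2 19,
      copy_action 19 2 3, copy_action 20 2 3, copy_action 21 5 3]"

section \<open>The zig-zag machine and its running time\<close>

definition zigzag_machine :: machine where
  "zigzag_machine = \<lparr>num_tapes = 7, prog = zigzag_prog\<rparr>"

lemma zigzag_machine_simps [simp]:
  "num_tapes zigzag_machine = 7" "prog zigzag_machine = zigzag_prog"
  by (simp_all add: zigzag_machine_def)

lemma length_zigzag_prog [simp]: "length zigzag_prog = 22"
  by (simp add: zigzag_prog_def rewind_actions_def)

lemma wf_zigzag_machine: "wf_machine zigzag_machine"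
  by (auto simp: wf_machine_def zigzag_prog_def copy_action_def rewind_actions_def)

lemma zigzag_prog_nth:
  "zigzag_prog ! 0 = copy_action 0 0 6"
  "zigzag_prog ! Suc 0 = copy_action (Suc 0) 0 6"
  "zigzag_prog ! 2 = copy_action 2 0 6"
  "zigzag_prog ! 3 = copy_action 3 0 4"
  "[zigzag_prog ! 4, zigzag_prog ! 5] = rewind_actions 4 4"
  "zigzag_prog ! 6 = copy_action 6 0 1"
  "zigzag_prog ! 7 = copy_action 7 0 1"
  "zigzag_prog ! 8 = Ask2 9"
  "zigzag_prog ! 9 = copy_action 9 4 1"
  "zigzag_prog ! 10 = copy_action 10 2 1"
  "zigzag_prog ! 11 = copy_action 11 2 5"
  "[zigzag_prog ! 12, zigzag_prog ! 13] = rewind_actions 12 5"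
  "zigzag_prog ! 14 = Ask1 15"
  "zigzag_prog ! 15 = copy_action 15 2 3"
  "zigzag_prog ! 16 = copy_action 16 2 1"
  "zigzag_prog ! 17 = copy_action 17 0 1"
  "zigzag_prog ! 18 = Ask2 19"
  "zigzag_prog ! 19 = copy_action 19 2 3"
  "zigzag_prog ! 20 = copy_action 20 2 3"
  "zigzag_prog ! 21 = copy_action 21 5 3"
  by (simp_all add: zigzag_prog_def rewind_actions_def)

text \<open>Symbolic execution with an exact step count. \<open>v\<close> and \<open>i'\<close>
  count three times each: saved, rewound over and copied back. The constant 7 is three queries plus
  two extra steps for each of two rewinds.\<close>

lemma zigzag_machine_run:
  assumes f2: "f2 (encode [k, i]) = encode [k', i']"
    and f1: "f1 (encode [v, k']) = encode [w, l']"
    and f2': "f2 (encode [l', j]) = encode [l, j']"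
  shows "\<exists>ts. run zigzag_machine f1 f2
      (init_config zigzag_machine (encode [N1, D1, D2, v, k, i, j]))
      (cost N1 + cost D1 + cost D2 + 3 * cost v + cost k + cost i + 3 * cost i' + cost k'
       + cost w + cost l' + cost j + cost l + cost j' + 7) 1 2 (22, ts) \<and>
      word_of (ts ! 3) = encode [w, l, j', i']"
proof -
  let ?run = "run zigzag_machine f1 f2"
  let ?in = "nums_tape [N1, D1, D2, v, k, i, j]"
  let ?T = nums_tape
  let ?e = "nums_tape [] 0"
  let ?junk = "nums_tape [N1, D1, D2] 3"
  note nth = zigzag_prog_nth numeral_2_eq_2[symmetric]
  note copy = run_copy[where M = zigzag_machine and ?f1.0 = f1 and ?f2.0 = f2]
  note rewind = run_rewind_nums[where M = zigzag_machine and ?f1.0 = f1 and ?f2.0 = f2]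
  have init: "init_config zigzag_machine (encode [N1, D1, D2, v, k, i, j]) =
      (0, [?in 0, ?e, ?e, ?e, ?e, ?e, ?e])"
    using tape_of_encode[of "[]"] tape_of_encode[of "[N1, D1, D2, v, k, i, j]"]
    by (simp add: init_config_def numeral_eq_Suc)
  \<comment> \<open>Each of the following facts executes one block of the program; the list shows
    tapes 0 to 6.\<close>
  have s0: "?run (0, [?in 0, ?e, ?e, ?e, ?e, ?e, ?e])
      (cost N1) 0 0
      (1, [?in 1, ?e, ?e, ?e, ?e, ?e, ?T [N1] 1])"
    using copy[of 0 0 6 "[?in 0, ?e, ?e, ?e, ?e, ?e, ?e]" 0 "[N1, D1, D2, v, k, i, j]" "[]"]
    by (simp add: nth)
  have s1: "?run (1, [?in 1, ?e, ?e, ?e, ?e, ?e, ?T [N1] 1])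
      (cost D1) 0 0
      (2, [?in 2, ?e, ?e, ?e, ?e, ?e, ?T [N1, D1] 2])"
    using copy[of 1 0 6
        "[?in 1, ?e, ?e, ?e, ?e, ?e, ?T [N1] 1]"
        1 "[N1, D1, D2, v, k, i, j]" "[N1]"]
    by (simp add: nth)
  have s2: "?run (2, [?in 2, ?e, ?e, ?e, ?e, ?e, ?T [N1, D1] 2])
      (cost D2) 0 0
      (3, [?in 3, ?e, ?e, ?e, ?e, ?e, ?junk])"
    using copy[of 2 0 6
        "[?in 2, ?e, ?e, ?e, ?e, ?e, ?T [N1, D1] 2]"
        2 "[N1, D1, D2, v, k, i, j]" "[N1, D1]"]
    by (simp add: nth)
  have s3: "?run (3, [?in 3, ?e, ?e, ?e, ?e, ?e, ?junk])
      (cost v) 0 0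
      (4, [?in 4, ?e, ?e, ?e, ?T [v] 1, ?e, ?junk])"
    using copy[of 3 0 4 "[?in 3, ?e, ?e, ?e, ?e, ?e, ?junk]" 3 "[N1, D1, D2, v, k, i, j]" "[]"]
    by (simp add: nth)
  have s4: "?run (4, [?in 4, ?e, ?e, ?e, ?T [v] 1, ?e, ?junk])
      (cost v + 2) 0 0
      (6, [?in 4, ?e, ?e, ?e, ?T [v] 0, ?e, ?junk])"
    using rewind[of 4 4 "[?in 4, ?e, ?e, ?e, ?T [v] 1, ?e, ?junk]" "[v]"] by (simp add: nth)
  have s5: "?run (6, [?in 4, ?e, ?e, ?e, ?T [v] 0, ?e, ?junk])
      (cost k) 0 0
      (7, [?in 5, ?T [k] 1, ?e, ?e, ?T [v] 0, ?e, ?junk])"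
    using copy[of 6 0 1
        "[?in 4, ?e, ?e, ?e, ?T [v] 0, ?e, ?junk]"
        4 "[N1, D1, D2, v, k, i, j]" "[]"]
    by (simp add: nth)
  have s6: "?run (7, [?in 5, ?T [k] 1, ?e, ?e, ?T [v] 0, ?e, ?junk])
      (cost i) 0 0
      (8, [?in 6, ?T [k, i] 2, ?e, ?e, ?T [v] 0, ?e, ?junk])"
    using copy[of 7 0 1
        "[?in 5, ?T [k] 1, ?e, ?e, ?T [v] 0, ?e, ?junk]"
        5 "[N1, D1, D2, v, k, i, j]" "[k]"]
    by (simp add: nth)
  have s7: "?run (8, [?in 6, ?T [k, i] 2, ?e, ?e, ?T [v] 0, ?e, ?junk])
      1 0 1
      (9, [?in 6, ?e, ?T [k', i'] 0, ?e, ?T [v] 0, ?e, ?junk])"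
    using run_ask2[of 8 zigzag_machine 9
        "[?in 6, ?T [k, i] 2, ?e, ?e, ?T [v] 0, ?e, ?junk]"
        "[k, i]" 2 f2 "[k', i']" f1] f2
    by (simp add: nth)
  have s8: "?run (9, [?in 6, ?e, ?T [k', i'] 0, ?e, ?T [v] 0, ?e, ?junk])
      (cost v) 0 0
      (10, [?in 6, ?T [v] 1, ?T [k', i'] 0, ?e, ?T [v] 1, ?e, ?junk])"
    using copy[of 9 4 1 "[?in 6, ?e, ?T [k', i'] 0, ?e, ?T [v] 0, ?e, ?junk]" 0 "[v]" "[]"]
    by (simp add: nth)
  have s9: "?run (10, [?in 6, ?T [v] 1, ?T [k', i'] 0, ?e, ?T [v] 1, ?e, ?junk])
      (cost k') 0 0
      (11, [?in 6, ?T [v, k'] 2, ?T [k', i'] 1, ?e, ?T [v] 1, ?e, ?junk])"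
    using copy[of 10 2 1
        "[?in 6, ?T [v] 1, ?T [k', i'] 0, ?e, ?T [v] 1, ?e, ?junk]"
        0 "[k', i']" "[v]"]
    by (simp add: nth)
  have s10: "?run (11, [?in 6, ?T [v, k'] 2, ?T [k', i'] 1, ?e, ?T [v] 1, ?e, ?junk])
      (cost i') 0 0
      (12, [?in 6, ?T [v, k'] 2, ?T [k', i'] 2, ?e, ?T [v] 1, ?T [i'] 1, ?junk])"
    using copy[of 11 2 5
        "[?in 6, ?T [v, k'] 2, ?T [k', i'] 1, ?e, ?T [v] 1, ?e, ?junk]"
        1 "[k', i']" "[]"]
    by (simp add: nth)
  have s11: "?run (12, [?in 6, ?T [v, k'] 2, ?T [k', i'] 2, ?e, ?T [v] 1, ?T [i'] 1, ?junk])
      (cost i' + 2) 0 0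
      (14, [?in 6, ?T [v, k'] 2, ?T [k', i'] 2, ?e, ?T [v] 1, ?T [i'] 0, ?junk])"
    using rewind[of 12 5
        "[?in 6, ?T [v, k'] 2, ?T [k', i'] 2, ?e, ?T [v] 1, ?T [i'] 1, ?junk]"
        "[i']"]
    by (simp add: nth)
  have s12: "?run (14, [?in 6, ?T [v, k'] 2, ?T [k', i'] 2, ?e, ?T [v] 1, ?T [i'] 0, ?junk])
      1 1 0
      (15, [?in 6, ?e, ?T [w, l'] 0, ?e, ?T [v] 1, ?T [i'] 0, ?junk])"
    using run_ask1[of 14 zigzag_machine 15
        "[?in 6, ?T [v, k'] 2, ?T [k', i'] 2, ?e, ?T [v] 1, ?T [i'] 0, ?junk]"
        "[v, k']" 2 f1 "[w, l']" f2] f1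
    by (simp add: nth)
  have s13: "?run (15, [?in 6, ?e, ?T [w, l'] 0, ?e, ?T [v] 1, ?T [i'] 0, ?junk])
      (cost w) 0 0
      (16, [?in 6, ?e, ?T [w, l'] 1, ?T [w] 1, ?T [v] 1, ?T [i'] 0, ?junk])"
    using copy[of 15 2 3
        "[?in 6, ?e, ?T [w, l'] 0, ?e, ?T [v] 1, ?T [i'] 0, ?junk]"
        0 "[w, l']" "[]"]
    by (simp add: nth)
  have s14: "?run (16, [?in 6, ?e, ?T [w, l'] 1, ?T [w] 1, ?T [v] 1, ?T [i'] 0, ?junk])
      (cost l') 0 0
      (17, [?in 6, ?T [l'] 1, ?T [w, l'] 2, ?T [w] 1, ?T [v] 1, ?T [i'] 0, ?junk])"
    using copy[of 16 2 1
        "[?in 6, ?e, ?T [w, l'] 1, ?T [w] 1, ?T [v] 1, ?T [i'] 0, ?junk]"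
        1 "[w, l']" "[]"]
    by (simp add: nth)
  \<comment> \<open>After reading \<open>i\<close> the input head has been resting on
    \<open>j\<close>, so the second small query is completed directly from the input tape.\<close>
  have s15: "?run (17, [?in 6, ?T [l'] 1, ?T [w, l'] 2, ?T [w] 1, ?T [v] 1, ?T [i'] 0, ?junk])
      (cost j) 0 0
      (18, [?in 7, ?T [l', j] 2, ?T [w, l'] 2, ?T [w] 1, ?T [v] 1, ?T [i'] 0, ?junk])"
    using copy[of 17 0 1
        "[?in 6, ?T [l'] 1, ?T [w, l'] 2, ?T [w] 1, ?T [v] 1, ?T [i'] 0, ?junk]"
        6 "[N1, D1, D2, v, k, i, j]" "[l']"]
    by (simp add: nth)
  have s16: "?run (18, [?in 7, ?T [l', j] 2, ?T [w, l'] 2, ?T [w] 1, ?T [v] 1, ?T [i'] 0, ?junk])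
      1 0 1
      (19, [?in 7, ?e, ?T [l, j'] 0, ?T [w] 1, ?T [v] 1, ?T [i'] 0, ?junk])"
    using run_ask2[of 18 zigzag_machine 19
        "[?in 7, ?T [l', j] 2, ?T [w, l'] 2, ?T [w] 1, ?T [v] 1, ?T [i'] 0, ?junk]"
        "[l', j]" 2 f2 "[l, j']" f1] f2'
    by (simp add: nth)
  have s17: "?run (19, [?in 7, ?e, ?T [l, j'] 0, ?T [w] 1, ?T [v] 1, ?T [i'] 0, ?junk])
      (cost l) 0 0
      (20, [?in 7, ?e, ?T [l, j'] 1, ?T [w, l] 2, ?T [v] 1, ?T [i'] 0, ?junk])"
    using copy[of 19 2 3
        "[?in 7, ?e, ?T [l, j'] 0, ?T [w] 1, ?T [v] 1, ?T [i'] 0, ?junk]"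
        0 "[l, j']" "[w]"]
    by (simp add: nth)
  have s18: "?run (20, [?in 7, ?e, ?T [l, j'] 1, ?T [w, l] 2, ?T [v] 1, ?T [i'] 0, ?junk])
      (cost j') 0 0
      (21, [?in 7, ?e, ?T [l, j'] 2, ?T [w, l, j'] 3, ?T [v] 1, ?T [i'] 0, ?junk])"
    using copy[of 20 2 3
        "[?in 7, ?e, ?T [l, j'] 1, ?T [w, l] 2, ?T [v] 1, ?T [i'] 0, ?junk]"
        1 "[l, j']" "[w, l]"]
    by (simp add: nth)
  have s19: "?run (21, [?in 7, ?e, ?T [l, j'] 2, ?T [w, l, j'] 3, ?T [v] 1, ?T [i'] 0, ?junk])
      (cost i') 0 0
      (22, [?in 7, ?e, ?T [l, j'] 2, ?T [w, l, j', i'] 4, ?T [v] 1, ?T [i'] 1, ?junk])"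
    using copy[of 21 5 3
        "[?in 7, ?e, ?T [l, j'] 2, ?T [w, l, j'] 3, ?T [v] 1, ?T [i'] 0, ?junk]"
        0 "[i']" "[w, l, j']"]
    by (simp add: nth)
  have run: "?run (init_config zigzag_machine (encode [N1, D1, D2, v, k, i, j]))
      (cost N1 + cost D1 + cost D2 + 3 * cost v + cost k + cost i + 3 * cost i' + cost k'
       + cost w + cost l' + cost j + cost l + cost j' + 7) 1 2
      (22, [?in 7, ?e, ?T [l, j'] 2, ?T [w, l, j', i'] 4, ?T [v] 1, ?T [i'] 1, ?junk])"
    unfolding init
    by (rule run_cong[OF run_trans[OF s0 run_trans[OF s1 run_trans[OF s2 run_trans[OF s3
      run_trans[OF s4 run_trans[OF s5 run_trans[OF s6 run_trans[OF s7 run_trans[OF s8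
      run_trans[OF s9 run_trans[OF s10 run_trans[OF s11 run_trans[OF s12 run_trans[OF s13
      run_trans[OF s14 run_trans[OF s15 run_trans[OF s16 run_trans[OF s17 run_trans[OF s18
      s19]]]]]]]]]]]]]]]]]]]]) simp_all
  show ?thesis by (intro exI conjI, rule run) (simp add: word_of_nums_tape)
qed

lemma zigzag_machine_computes:
  assumes G1: "regular_graph {1..N1} {1..D1} R1" and G2: "regular_graph {1..D1} {1..D2} R2"
    and f1: "oracle_for {1..N1} {1..D1} R1 f1" and f2: "oracle_for {1..D1} {1..D2} R2 f2"
    and vkij: "v \<in> {1..N1}" "k \<in> {1..D1}" "i \<in> {1..D2}" "j \<in> {1..D2}"
  shows "computes_within zigzag_machine f1 f2 (encode [N1, D1, D2, v, k, i, j])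
    (encode_pairs (zigzag R1 R2 ((v, k), (i, j))))
    (41 + 5 * log 2 (real N1) + 5 * log 2 (real D1) + 7 * log 2 (real D2)) 1 2"
proof -
  have R1: "R1 (a, b) \<in> {1..N1} \<times> {1..D1}" if "a \<in> {1..N1}" "b \<in> {1..D1}" for a b
    using G1 that by (auto simp: regular_graph_def)
  have R2: "R2 (a, b) \<in> {1..D1} \<times> {1..D2}" if "a \<in> {1..D1}" "b \<in> {1..D2}" for a b
    using G2 that by (auto simp: regular_graph_def)
  obtain k' i' where s1: "R2 (k, i) = (k', i')" by (cases "R2 (k, i)")
  with R2[OF vkij(2,3)] have in1: "k' \<in> {1..D1}" "i' \<in> {1..D2}" by auto
  obtain w l' where s2: "R1 (v, k') = (w, l')" by (cases "R1 (v, k')")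
  with R1[OF vkij(1) in1(1)] have in2: "w \<in> {1..N1}" "l' \<in> {1..D1}" by auto
  obtain l j' where s3: "R2 (l', j) = (l, j')" by (cases "R2 (l', j)")
  with R2[OF in2(2) vkij(4)] have in3: "l \<in> {1..D1}" "j' \<in> {1..D2}" by auto
  have "f2 (encode [k, i]) = encode [k', i']" "f1 (encode [v, k']) = encode [w, l']"
    "f2 (encode [l', j]) = encode [l, j']"
    using f1 f2 vkij in1 in2 s1 s2 s3 unfolding oracle_for_def by (metis fst_conv snd_conv)+
  from zigzag_machine_run[of f2 k i k' i' f1 v w l' j l j' N1 D1 D2, OF this]
  obtain ts where run: "run zigzag_machine f1 f2
      (init_config zigzag_machine (encode [N1, D1, D2, v, k, i, j]))
      (cost N1 + cost D1 + cost D2 + 3 * cost v + cost k + cost i + 3 * cost i' + cost k'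
       + cost w + cost l' + cost j + cost l + cost j' + 7) 1 2 (22, ts)"
    and out: "word_of (ts ! 3) = encode [w, l, j', i']"
    by blast
  have c: "real (cost a) \<le> log 2 (real N) + 2" if "a \<in> {1..N}" for a N
    using that by (intro cost_le) auto
  \<comment> \<open>The given vertex and labels make all ranges nonempty, so the parameters are
    positive and fall under \<open>cost_le\<close> as well.\<close>
  have "N1 \<in> {1..N1}" "D1 \<in> {1..D1}" "D2 \<in> {1..D2}" using vkij by auto
  note costs = this[THEN c] vkij[THEN c] in1[THEN c] in2[THEN c] in3[THEN c]
  \<comment> \<open>With multiplicity, 5 costs are bounded through \<open>N1\<close>, 5 through
    \<open>D1\<close> and 7 through \<open>D2\<close>; each contributes 2 besides its logarithm, and
    \<open>2 * 17 + 7 = 41\<close>.\<close>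
  have time: "real (cost N1 + cost D1 + cost D2 + 3 * cost v + cost k + cost i + 3 * cost i'
       + cost k' + cost w + cost l' + cost j + cost l + cost j' + 7)
      \<le> 41 + 5 * log 2 (real N1) + 5 * log 2 (real D1) + 7 * log 2 (real D2)"
    unfolding of_nat_add of_nat_mult of_nat_numeral using costs by linarith
  have "zigzag R1 R2 ((v, k), (i, j)) = ((w, l), (j', i'))"
    using s1 s2 s3 by (simp add: zigzag_def)
  then have "word_of (snd (22 :: nat, ts) ! 3) = encode_pairs (zigzag R1 R2 ((v, k), (i, j)))"
    by (simp add: out encode_pairs_def)
  moreover have "halted zigzag_machine (22, ts)" by (simp add: halted_def)
  ultimately show ?thesis unfolding computes_within_def using run time by blast
qed

lemma polynomial3_affine: "polynomial3 (\<lambda>x y z. a + b * x + c * y + d * z)"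
  unfolding polynomial3_def
  \<comment> \<open>Degree 1 in each variable suffices; the coefficients vanish in total degree
    above 1, and the innermost \<open>else\<close> is the case \<open>k = 1\<close>.\<close>
  by (rule exI[of _ 1], rule exI[of _ "\<lambda>i j k. if i + j + k = 0 then a else
        if i + j + k = 1 then (if i = 1 then b else if j = 1 then c else d) else 0"]) simp

theorem theorem3p2:
  "\<exists>f :: real \<Rightarrow> real \<Rightarrow> real.
     (\<forall>l1 l2. 0 \<le> l1 \<longrightarrow> 0 \<le> l2 \<longrightarrow> f l1 l2 \<le> l1 + l2 + l2\<^sup>2) \<and>
     (\<forall>l1 l2. 0 \<le> l1 \<longrightarrow> 0 \<le> l2 \<longrightarrow> l1 < 1 \<longrightarrow> l2 < 1 \<longrightarrow> f l1 l2 < 1) \<and>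
     (\<forall>(N1::nat) (D1::nat) (D2::nat) l1 l2 Rot1 Rot2.
        0 \<le> l1 \<longrightarrow> 0 \<le> l2 \<longrightarrow>
        expander_graph {1..N1} {1..D1} Rot1 N1 D1 l1 \<longrightarrow>
        expander_graph {1..D1} {1..D2} Rot2 D1 D2 l2 \<longrightarrow>
        expander_graph ({1..N1} \<times> {1..D1}) ({1..D2} \<times> {1..D2}) (zigzag Rot1 Rot2)
          (N1 * D1) (D2\<^sup>2) (f l1 l2)) \<and>
     (\<exists>M p. wf_machine M \<and> polynomial3 p \<and>
        (\<forall>(N1::nat) (D1::nat) (D2::nat) Rot1 Rot2 f1 f2.
           regular_graph {1..N1} {1..D1} Rot1 \<longrightarrow>
           regular_graph {1..D1} {1..D2} Rot2 \<longrightarrow>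
           oracle_for {1..N1} {1..D1} Rot1 f1 \<longrightarrow>
           oracle_for {1..D1} {1..D2} Rot2 f2 \<longrightarrow>
           (\<forall>v\<in>{1..N1}. \<forall>k\<in>{1..D1}. \<forall>i\<in>{1..D2}. \<forall>j\<in>{1..D2}.
              computes_within M f1 f2
                (encode [N1, D1, D2, v, k, i, j])
                (encode_pairs (zigzag Rot1 Rot2 ((v, k), (i, j))))
                (p (log 2 (real N1)) (log 2 (real D1)) (log 2 (real D2)))
                1 2)))"
proof (intro exI[of _ zigzag_bound] exI[of _ zigzag_machine]
    exI[of _ "\<lambda>x y z. 41 + 5 * x + 5 * y + 7 * z"] conjI allI impI ballI)
qed (assumption | rule zigzag_bound_le zigzag_bound_less_1 expander_graph_zigzag
    wf_zigzag_machine polynomial3_affine zigzag_machine_computes)+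

end
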